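(* Let $(X_1,X_2)$ be centered bivariate Gaussian random variables with $\mathbf{E}[X_1^2]=\sigma_1^2$, $\mathbf{E}[X_2^2]=\sigma_2^2$, where $\sigma_1,\sigma_2>0$, and with correlation coefficient $\rho$ satisfying $|\rho|<1$. Let $\alpha_1\in(-1,0)$ and $\alpha_2\in(0,\infty)$. (i) When $0<\alpha_2\le 2$, $$\frac{2^{\frac{\alpha_1+\alpha_2}{2}}\alpha_1\alpha_2\sigma_1^{\alpha_1}\sigma_2^{\alpha_2}\rho^2}{2\pi}\,\Gamma\left(\frac{\alpha_1+1}{2}\right)\Gamma\left(\frac{\alpha_2+1}{2}\right)F\left(1-\frac{\alpha_1}{2},1-\frac{\alpha_2}{2};\frac32;1\right)$$ $$\le\ \mathbf{E}[|X_1|^{\alpha_1}|X_2|^{\alpha_2}]-\mathbf{E}[|X_1|^{\alpha_1}]\,\mathbf{E}[|X_2|^{\alpha_2}]$$ $$\le\ \frac{2^{\frac{\alpha_1+\alpha_2}{2}}\alpha_1\alpha_2\sigma_1^{\alpha_1}\sigma_2^{\alpha_2}\rho^2}{2\pi}\,\Gamma\left(\frac{\alpha_1+1}{2}\right)\Gamma\left(\frac{\alpha_2+1}{2}\right)\ \le\ 0.$$ (ii) When $\alpha_2>2$, $$\frac{2^{\frac{\alpha_1+\alpha_2}{2}}\alpha_1\alpha_2\sigma_1^{\alpha_1}\sigma_2^{\alpha_2}\rho^2}{2\pi}\,\Gamma\left(\frac{\alpha_1+1}{2}\right)\Gamma\left(\frac{\alpha_2+1}{2}\right)$$ $$\le\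 \mathbf{E}[|X_1|^{\alpha_1}|X_2|^{\alpha_2}]-\mathbf{E}[|X_1|^{\alpha_1}]\,\mathbf{E}[|X_2|^{\alpha_2}]$$ $$\le\ \min\left\{\frac{2^{\frac{\alpha_1+\alpha_2}{2}}\alpha_1\alpha_2\sigma_1^{\alpha_1}\sigma_2^{\alpha_2}\rho^2}{2\pi}\,\Gamma\left(\frac{\alpha_1+1}{2}\right)\Gamma\left(\frac{\alpha_2+1}{2}\right)F\left(1-\frac{\alpha_1}{2},1-\frac{\alpha_2}{2};\frac32;1\right),\ 0\right\}.$$
   Context: $\Gamma$ denotes the Gamma function. All Gaussian random variables are real-valued and non-degenerate. The correlation coefficient is $\rho=\mathbf{E}[X_1X_2]/(\sigma_1\sigma_2)$. $F$ is the hypergeometric function defined by $$F(a,b;c;z):=\sum_{n=0}^{+\infty}\frac{(a)_n(b)_n}{(c)_n}\cdot\frac{z^n}{n!},\qquad |z|\le 1,$$ where, for $\alpha\in\mathbb{R}$, $(\alpha)_n:=\alpha(\alpha+1)\cdots(\alpha+n-1)$ for $n\ge 1$ and $(\alpha)_0:=1$. *)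

theory Defs
  imports "HOL-Probability.Probability"
begin

text \<open>
  The Gauss hypergeometric series. It takes values in the extended reals because the
  value at \<open>z = 1\<close> is needed also when \<open>c - a - b \<le> 0\<close>; for \<open>a, b, c > 0\<close> the series
  then diverges to \<open>\<infinity>\<close>. The sum is the limit of the partial sums in the order given,
  so series with terms of both signs are covered; where the real series converges,
  this is its ordinary real value (lemma below).
\<close>

definition hypergeo_F :: "real \<Rightarrow> real \<Rightarrow> real \<Rightarrow> real \<Rightarrow> ereal" where
  "hypergeo_F a b c z =
     (\<Sum>n. ereal (pochhammer a n * pochhammer b n / pochhammer c n * (z ^ n / fact n)))"

lemma hypergeo_F_eq_real:
  assumes "summable (\<lambda>n. pochhammer a n * pochhammer b n / pochhammer c n * (z ^ n / fact n))"
  shows "hypergeo_F a b c z =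
    ereal (\<Sum>n. pochhammer a n * pochhammer b n / pochhammer c n * (z ^ n / fact n))"
  unfolding hypergeo_F_def
  by (rule sums_unique [symmetric], unfold sums_ereal, rule summable_sums, rule assms)

definition std_gaussian :: "real measure" where
  "std_gaussian = density lborel (\<lambda>x. ennreal (std_normal_density x))"

text \<open>
  A pair is bivariate Gaussian if its joint law is the law of \<open>\<mu> + A Z\<close> for a vector
  \<open>\<mu>\<close>, a \<open>2 \<times> 2\<close> matrix \<open>A\<close> and a pair \<open>Z\<close> of independent standard normal variables.
  Singular \<open>A\<close> is allowed.
\<close>

definition bivariate_gaussian :: "'a measure \<Rightarrow> ('a \<Rightarrow> real) \<Rightarrow> ('a \<Rightarrow> real) \<Rightarrow> bool" where
  "bivariate_gaussian M X1 X2 \<longleftrightarrow>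
     X1 \<in> borel_measurable M \<and> X2 \<in> borel_measurable M \<and>
     (\<exists>\<mu>1 \<mu>2 a11 a12 a21 a22.
        distr M (borel \<Otimes>\<^sub>M borel) (\<lambda>\<omega>. (X1 \<omega>, X2 \<omega>)) =
        distr (std_gaussian \<Otimes>\<^sub>M std_gaussian) (borel \<Otimes>\<^sub>M borel)
          (\<lambda>(z1, z2). (\<mu>1 + a11 * z1 + a12 * z2, \<mu>2 + a21 * z1 + a22 * z2)))"

end

theory Submission
  imports Defs
begin

text \<open>
  Put \<open>s = -\<alpha>\<^sub>1\<close>, \<open>p = \<alpha>\<^sub>2 / 2\<close> and \<open>z = \<rho>\<^sup>2\<close>. Writing \<open>\<bar>x\<bar>\<^sup>-\<^sup>s\<close> as a Laplace-type integral of
  \<open>exp (-u x\<^sup>2)\<close> over \<open>u > 0\<close> and integrating out the Gaussian pair (the weight \<open>exp (-u X\<^sub>1\<^sup>2)\<close> only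
  changes the covariance) shows that \<open>E[\<bar>X\<^sub>1\<bar>\<^sup>-\<^sup>s \<bar>X\<^sub>2\<bar>\<^sup>2\<^sup>p]\<close> is the product of the two marginal moments
  times \<open>R = E[(1 - z T)\<^sup>p]\<close>, where \<open>T = U / (1 + U)\<close> has the distribution Beta\<open>(s/2, (1-s)/2)\<close> and
  mean \<open>s\<close>. Up to that product the constant \<open>K\<close> of the theorem is \<open>-s p z\<close>, so one bound is
  Bernoulli's inequality \<open>(1 - w)\<^sup>p \<le> 1 - p w\<close> (reversed for \<open>p > 1\<close>) at \<open>w = z T\<close>. For the other,
  Bernoulli at \<open>1 / (1 - w)\<close> compares \<open>1 - (1 - w)\<^sup>p\<close> with \<open>p w (1 - w)\<^sup>p\<^sup>-\<^sup>1\<close>, and by Euler's integral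
  \<open>E[T (1 - T)\<^sup>p\<^sup>-\<^sup>1] = s F(1 + s/2, 1 - p; 3/2; 1)\<close>.
\<close>

subsection \<open>Linear images of a standard Gaussian pair\<close>

lemma prob_space_std_gaussian: "prob_space std_gaussian"
  unfolding std_gaussian_def by (rule prob_space_normal_density) simp

lemma sets_std_gaussian [measurable_cong, simp]: "sets std_gaussian = sets borel"
  by (simp add: std_gaussian_def)

lemma space_std_gaussian [simp]: "space std_gaussian = UNIV"
  by (simp add: std_gaussian_def)

lemma nn_integral_std_gaussian:
  assumes [measurable]: "g \<in> borel_measurable borel"
  shows "(\<integral>\<^sup>+x. g x \<partial>std_gaussian) = (\<integral>\<^sup>+x. ennreal (std_normal_density x) * g x \<partial>lborel)"
  unfolding std_gaussian_def by (subst nn_integral_density) auto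

lemma nn_integral_std_gaussian_pair:
  assumes [measurable]: "f \<in> borel_measurable (borel \<Otimes>\<^sub>M borel)"
  shows "(\<integral>\<^sup>+p. f p \<partial>(std_gaussian \<Otimes>\<^sub>M std_gaussian)) =
    (\<integral>\<^sup>+y. \<integral>\<^sup>+x. ennreal (std_normal_density x * std_normal_density y) * f (x, y) \<partial>lborel \<partial>lborel)"
proof -
  interpret prob_space std_gaussian by (rule prob_space_std_gaussian)
  interpret P: pair_sigma_finite std_gaussian std_gaussian ..
  have "(\<integral>\<^sup>+p. f p \<partial>(std_gaussian \<Otimes>\<^sub>M std_gaussian)) =
      (\<integral>\<^sup>+y. \<integral>\<^sup>+x. f (x, y) \<partial>std_gaussian \<partial>std_gaussian)"
    by (subst P.nn_integral_snd [symmetric]) auto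
  also have "\<dots> = (\<integral>\<^sup>+y. ennreal (std_normal_density y) *
      (\<integral>\<^sup>+x. ennreal (std_normal_density x) * f (x, y) \<partial>lborel) \<partial>lborel)"
    by (subst nn_integral_std_gaussian, measurable)+
  also have "\<dots> = (\<integral>\<^sup>+y. \<integral>\<^sup>+x. ennreal (std_normal_density x * std_normal_density y) * f (x, y) \<partial>lborel \<partial>lborel)"
    by (subst nn_integral_cmult [symmetric]) (auto simp: ennreal_mult mult_ac intro!: nn_integral_cong)
  finally show ?thesis .
qed

text \<open>Both variances are normalised to 1. The scales \<open>\<sigma>1\<close> and
  \<open>\<sigma>2\<close> are put back later through the arguments of the integrand.\<close>

definition binormal_density :: "real \<Rightarrow> real \<Rightarrow> real \<Rightarrow> real" where
  "binormal_density \<rho> x y =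
     exp (- (x\<^sup>2 - 2 * \<rho> * x * y + y\<^sup>2) / (2 * (1 - \<rho>\<^sup>2))) / (2 * pi * sqrt (1 - \<rho>\<^sup>2))"

lemma borel_measurable_binormal_density [measurable]:
  assumes [measurable]: "f \<in> borel_measurable N" "g \<in> borel_measurable N"
  shows "(\<lambda>p. binormal_density \<rho> (f p) (g p)) \<in> borel_measurable N"
  unfolding binormal_density_def by measurable

lemma binormal_density_nonneg: "\<bar>\<rho>\<bar> < 1 \<Longrightarrow> binormal_density \<rho> x y \<ge> 0"
  unfolding binormal_density_def by (simp add: abs_square_less_1 less_imp_le)

text \<open>A linear change of variables in the plane, done as two one-dimensional affine
  substitutions with Tonelli in between. The first one divides by \<open>a\<close>, whence
  \<open>a \<noteq> 0\<close>. The Jacobians \<open>1 / a\<close> and \<open>a / D\<close> combine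
  to \<open>1 / D\<close>, with \<open>D\<close> the determinant.\<close>

lemma nn_integral_std_gaussian_linear_aux:
  fixes a b c d :: real
  assumes [measurable]: "f \<in> borel_measurable (borel \<Otimes>\<^sub>M borel)"
    and rows: "a\<^sup>2 + b\<^sup>2 = 1" "c\<^sup>2 + d\<^sup>2 = 1" "a * c + b * d = \<rho>" and \<rho>: "\<bar>\<rho>\<bar> < 1" and a: "a \<noteq> 0"
  shows "(\<integral>\<^sup>+p. f (a * fst p + b * snd p, c * fst p + d * snd p) \<partial>(std_gaussian \<Otimes>\<^sub>M std_gaussian)) =
    (\<integral>\<^sup>+y. \<integral>\<^sup>+x. ennreal (binormal_density \<rho> x y) * f (x, y) \<partial>lborel \<partial>lborel)"
proof -
  define D where "D = a * d - b * c"
  \<comment> \<open>Lagrange's identity for the rows \<open>(a, b)\<close> and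
    \<open>(c, d)\<close>, which are unit vectors with inner product \<open>\<rho>\<close>.\<close>
  have D2: "D\<^sup>2 = 1 - \<rho>\<^sup>2"
  proof -
    have "D\<^sup>2 + (a * c + b * d)\<^sup>2 = (a\<^sup>2 + b\<^sup>2) * (c\<^sup>2 + d\<^sup>2)"
      by (simp add: D_def power2_eq_square algebra_simps)
    then show ?thesis using rows by simp
  qed
  have "\<rho>\<^sup>2 < 1" using \<rho> by (simp add: abs_square_less_1)
  then have D: "D \<noteq> 0" using D2 by auto
  have sD: "sqrt (1 - \<rho>\<^sup>2) = \<bar>D\<bar>" by (simp flip: D2)
  define \<phi> where "\<phi> = std_normal_density"
  have [measurable]: "\<phi> \<in> borel_measurable borel" by (simp add: \<phi>_def)
  have \<phi>0: "\<phi> x \<ge> 0" for x by (simp add: \<phi>_def)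
  \<comment> \<open>The arguments of \<open>\<phi>\<close> are the two coordinates of the inverse
    linear map at \<open>(x, y)\<close>.\<close>
  have dens: "\<bar>1 / D\<bar> * (\<phi> ((d * x - b * y) / D) * \<phi> ((a * y - c * x) / D)) = binormal_density \<rho> x y" for x y
  proof -
    have "(d * x - b * y)\<^sup>2 + (a * y - c * x)\<^sup>2 = (c\<^sup>2 + d\<^sup>2) * x\<^sup>2 - 2 * (a * c + b * d) * x * y + (a\<^sup>2 + b\<^sup>2) * y\<^sup>2"
      by (simp add: power2_eq_square algebra_simps)
    also have "\<dots> = x\<^sup>2 - 2 * \<rho> * x * y + y\<^sup>2" using rows by simp
    finally have "- ((d * x - b * y) / D)\<^sup>2 / 2 + - ((a * y - c * x) / D)\<^sup>2 / 2 =
        - (x\<^sup>2 - 2 * \<rho> * x * y + y\<^sup>2) / (2 * (1 - \<rho>\<^sup>2))"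
      using D by (simp add: power_divide D2[symmetric] field_simps)
    then show ?thesis
      by (simp add: \<phi>_def std_normal_density_def binormal_density_def sD exp_add [symmetric])
  qed
  have "(\<integral>\<^sup>+p. f (a * fst p + b * snd p, c * fst p + d * snd p) \<partial>(std_gaussian \<Otimes>\<^sub>M std_gaussian)) =
     (\<integral>\<^sup>+y. \<integral>\<^sup>+x. ennreal (\<phi> x * \<phi> y) * f (a * x + b * y, c * x + d * y) \<partial>lborel \<partial>lborel)"
    by (subst nn_integral_std_gaussian_pair) (simp_all add: \<phi>_def)
  \<comment> \<open>For fixed \<open>y\<close>, substitute so that the first argument of
    \<open>f\<close> becomes the variable \<open>x\<close>; the second argument is then
    \<open>(c * x + D * y) / a\<close>.\<close>
  also have "\<dots> = (\<integral>\<^sup>+y. ennreal \<bar>1/a\<bar> * (\<integral>\<^sup>+x. ennreal (\<phi> ((x - b * y) / a) * \<phi> y) * f (x, (c * x + D * y) / a) \<partial>lborel) \<partial>lborel)"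
    (is "_ = (\<integral>\<^sup>+y. ?L y \<partial>lborel)")
  proof (rule nn_integral_cong)
    fix y
    show "(\<integral>\<^sup>+x. ennreal (\<phi> x * \<phi> y) * f (a * x + b * y, c * x + d * y) \<partial>lborel) = ?L y"
      by (subst nn_integral_real_affine[where c = "1/a" and t = "- b * y / a"])
        (use a in \<open>auto simp: field_simps D_def intro!: nn_integral_cong arg_cong2[where f = "(*)"] arg_cong[where f = f]\<close>)
  qed
  also have "\<dots> = ennreal \<bar>1/a\<bar> * (\<integral>\<^sup>+y. \<integral>\<^sup>+x. ennreal (\<phi> ((x - b * y) / a) * \<phi> y) * f (x, (c * x + D * y) / a) \<partial>lborel \<partial>lborel)"
    by (rule nn_integral_cmult) measurable
  also have "(\<integral>\<^sup>+y. \<integral>\<^sup>+x. ennreal (\<phi> ((x - b * y) / a) * \<phi> y) * f (x, (c * x + D * y) / a) \<partial>lborel \<partial>lborel)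
    = (\<integral>\<^sup>+x. \<integral>\<^sup>+y. ennreal (\<phi> ((x - b * y) / a) * \<phi> y) * f (x, (c * x + D * y) / a) \<partial>lborel \<partial>lborel)"
    by (rule lborel_pair.Fubini') measurable
  \<comment> \<open>Now \<open>x\<close> is fixed and the second argument of \<open>f\<close>
    becomes the variable \<open>y\<close>.\<close>
  also have "\<dots> = (\<integral>\<^sup>+x. ennreal \<bar>a / D\<bar> * (\<integral>\<^sup>+y. ennreal (\<phi> ((d * x - b * y) / D) * \<phi> ((a * y - c * x) / D)) * f (x, y) \<partial>lborel) \<partial>lborel)"
    (is "_ = (\<integral>\<^sup>+x. ?R x \<partial>lborel)")
  proof (rule nn_integral_cong)
    fix x
    have e: "(x - b * (- c * x / D + a / D * y)) / a = (d * x - b * y) / D" for y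
    proof -
      have "x - b * (- c * x / D + a / D * y) = a * ((d * x - b * y) / D)"
        using D by (simp add: field_simps) (simp add: D_def algebra_simps)
      then show ?thesis using a by simp
    qed
    have e2: "(c * x + D * (- c * x / D + a / D * y)) / a = y" for y
      using D a by (simp add: field_simps)
    have e3: "- c * x / D + a / D * y = (a * y - c * x) / D" for y
      by (simp add: diff_divide_distrib)
    show "(\<integral>\<^sup>+y. ennreal (\<phi> ((x - b * y) / a) * \<phi> y) * f (x, (c * x + D * y) / a) \<partial>lborel) = ?R x"
      by (subst nn_integral_real_affine[where c = "a / D" and t = "- c * x / D"]) (use a D in \<open>simp_all only: e e2, simp_all only: e3, simp_all\<close>)
  qed
  also have "\<dots> = ennreal \<bar>a/D\<bar> * (\<integral>\<^sup>+x. \<integral>\<^sup>+y. ennreal (\<phi> ((d * x - b * y) / D) * \<phi> ((a * y - c * x) / D)) * f (x, y) \<partial>lborel \<partial>lborel)"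
    by (rule nn_integral_cmult) measurable
  also have "(\<integral>\<^sup>+x. \<integral>\<^sup>+y. ennreal (\<phi> ((d * x - b * y) / D) * \<phi> ((a * y - c * x) / D)) * f (x, y) \<partial>lborel \<partial>lborel)
     = (\<integral>\<^sup>+y. \<integral>\<^sup>+x. ennreal (\<phi> ((d * x - b * y) / D) * \<phi> ((a * y - c * x) / D)) * f (x, y) \<partial>lborel \<partial>lborel)"
    by (rule lborel_pair.Fubini') measurable
  also have "ennreal \<bar>1/a\<bar> * (ennreal \<bar>a/D\<bar> * \<dots>) = ennreal \<bar>1/D\<bar> * \<dots>"
    using a by (simp add: mult.assoc [symmetric] ennreal_mult' [symmetric] abs_mult abs_divide)
  also have "\<dots> = (\<integral>\<^sup>+y. \<integral>\<^sup>+x. ennreal \<bar>1/D\<bar> * (ennreal (\<phi> ((d * x - b * y) / D) * \<phi> ((a * y - c * x) / D)) * f (x, y)) \<partial>lborel \<partial>lborel)"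
    by (simp add: nn_integral_cmult)
  also have "\<dots> = (\<integral>\<^sup>+y. \<integral>\<^sup>+x. ennreal (binormal_density \<rho> x y) * f (x, y) \<partial>lborel \<partial>lborel)"
    by (simp only: dens [symmetric] ennreal_mult'[OF abs_ge_zero] mult.assoc)
  finally show ?thesis .
qed

lemma nn_integral_std_gaussian_linear:
  fixes a b c d :: real
  assumes [measurable]: "f \<in> borel_measurable (borel \<Otimes>\<^sub>M borel)"
    and rows: "a\<^sup>2 + b\<^sup>2 = 1" "c\<^sup>2 + d\<^sup>2 = 1" "a * c + b * d = \<rho>" and \<rho>: "\<bar>\<rho>\<bar> < 1"
  shows "(\<integral>\<^sup>+p. f (a * fst p + b * snd p, c * fst p + d * snd p) \<partial>(std_gaussian \<Otimes>\<^sub>M std_gaussian)) =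
    (\<integral>\<^sup>+y. \<integral>\<^sup>+x. ennreal (binormal_density \<rho> x y) * f (x, y) \<partial>lborel \<partial>lborel)"
proof (cases "a = 0")
  case False
  with assms show ?thesis by (intro nn_integral_std_gaussian_linear_aux) auto
next
  case True
  with rows have b: "b \<noteq> 0" by auto
  interpret prob_space std_gaussian by (rule prob_space_std_gaussian)
  interpret P: pair_sigma_finite std_gaussian std_gaussian ..
  \<comment> \<open>Exchanging the two independent coordinates exchanges the columns, so the nonzero
    entry \<open>b\<close> takes the place of \<open>a\<close>.\<close>
  have "(\<integral>\<^sup>+p. f (a * fst p + b * snd p, c * fst p + d * snd p) \<partial>(std_gaussian \<Otimes>\<^sub>M std_gaussian)) =
    (\<integral>\<^sup>+p. f (b * fst p + a * snd p, d * fst p + c * snd p) \<partial>(std_gaussian \<Otimes>\<^sub>M std_gaussian))"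
    by (subst P.distr_pair_swap, subst nn_integral_distr) (auto simp: split_beta add.commute)
  also have "\<dots> = (\<integral>\<^sup>+y. \<integral>\<^sup>+x. ennreal (binormal_density \<rho> x y) * f (x, y) \<partial>lborel \<partial>lborel)"
    using assms b by (intro nn_integral_std_gaussian_linear_aux) (auto simp: add.commute)
  finally show ?thesis .
qed

subsection \<open>Gamma, beta and absolute moment integrals\<close>

text \<open>Substitute \<open>t = c * u\<close> in Euler's integral for Gamma. Read from right to
  left, this represents the negative power \<open>c powr - x\<close> as a Laplace integral.\<close>

lemma nn_integral_powr_exp:
  fixes x c :: real
  assumes "x > 0" "c > 0"
  shows "(\<integral>\<^sup>+u. ennreal (indicator {0<..} u * u powr (x - 1) * exp (- c * u)) \<partial>lborel) = ennreal (Gamma x / c powr x)"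
proof -
  have "ennreal (Gamma x) = (\<integral>\<^sup>+t. ennreal (indicator {0..} t * t powr (x - 1) / exp t) \<partial>lborel)"
    by (rule Gamma_conv_nn_integral_real) fact
  also have "\<dots> = ennreal c * (\<integral>\<^sup>+t. ennreal (indicator {0..} (c * t) * (c * t) powr (x - 1) / exp (c * t)) \<partial>lborel)"
    by (subst nn_integral_real_affine[where c = c and t = 0]) (use assms in auto)
  also have "\<dots> = ennreal c * (\<integral>\<^sup>+t. ennreal (c powr (x - 1)) * ennreal (indicator {0<..} t * t powr (x - 1) * exp (- c * t)) \<partial>lborel)"
    using assms by (intro arg_cong2[where f = "(*)"] nn_integral_cong refl)
      (auto simp: ennreal_mult' [symmetric] indicator_def powr_mult exp_minus field_simps zero_le_mult_iff)
  also have "\<dots> = ennreal (c powr x) * (\<integral>\<^sup>+t. ennreal (indicator {0<..} t * t powr (x - 1) * exp (- c * t)) \<partial>lborel)"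
    using assms by (subst nn_integral_cmult) (auto simp: mult.assoc [symmetric] ennreal_mult' [symmetric] powr_mult_base)
  finally have *: "ennreal (Gamma x) = \<dots>" .
  have "ennreal (Gamma x / c powr x) = ennreal (inverse (c powr x)) * ennreal (Gamma x)"
    using assms by (simp add: ennreal_mult' [symmetric] field_simps)
  also have "\<dots> = (\<integral>\<^sup>+t. ennreal (indicator {0<..} t * t powr (x - 1) * exp (- c * t)) \<partial>lborel)"
    using assms by (simp only: * mult.assoc [symmetric]) (simp add: ennreal_mult' [symmetric])
  finally show ?thesis by simp
qed

text \<open>Under \<open>t = u / (1 + u)\<close> this is the Beta integrand
  \<open>t powr (x - 1) * (1 - t) powr (y - 1)\<close> including the Jacobian. The half-line form is
  the one in which the Laplace parameter appears.\<close>

definition beta_prime_kernel :: "real \<Rightarrow> real \<Rightarrow> real \<Rightarrow> real" where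
  "beta_prime_kernel x y u = indicator {0<..} u * u powr (x - 1) * (1 + u) powr - (x + y)"

lemma beta_prime_kernel_nonneg: "beta_prime_kernel x y u \<ge> 0"
  by (simp add: beta_prime_kernel_def)

lemma borel_measurable_beta_prime_kernel [measurable]:
  "beta_prime_kernel x y \<in> borel_measurable borel"
  unfolding beta_prime_kernel_def by measurable

text \<open>Expand \<open>\<Gamma>(x + y) (1 + u)\<^sup>-\<^sup>(\<^sup>x\<^sup>+\<^sup>y\<^sup>)\<close> as a gamma integral and exchange the integrals.\<close>

lemma nn_integral_beta_prime_kernel:
  fixes x y :: real
  assumes "x > 0" "y > 0"
  shows "(\<integral>\<^sup>+u. ennreal (beta_prime_kernel x y u) \<partial>lborel) = ennreal (Beta x y)"
proof -
  define h where "h a u = indicator {0<..} u * u powr (a - 1)" for a u :: real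
  have h0: "h a u \<ge> 0" for a u by (simp add: h_def)
  have [measurable]: "h a \<in> borel_measurable borel" for a unfolding h_def by measurable
  have k: "beta_prime_kernel x y u = h x u / (1 + u) powr (x + y)" for u
    unfolding beta_prime_kernel_def h_def by (simp only: powr_minus_divide times_divide_eq_right mult_1_right)
  have G: "Gamma x > 0" "Gamma y > 0" "Gamma (x + y) > 0"
    using assms by (auto intro!: Gamma_real_pos)
  have *: "(\<integral>\<^sup>+w. ennreal (h a w * exp (- c * w)) \<partial>lborel) = ennreal (Gamma a / c powr a)" if "a > 0" "c > 0" for a c
    using nn_integral_powr_exp[OF that] by (simp add: h_def)
  have "ennreal (Gamma (x + y)) * (\<integral>\<^sup>+u. ennreal (beta_prime_kernel x y u) \<partial>lborel) =
      (\<integral>\<^sup>+u. ennreal (h x u) * ennreal (Gamma (x + y) / (1 + u) powr (x + y)) \<partial>lborel)"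
    using G by (subst nn_integral_cmult [symmetric])
      (auto intro!: nn_integral_cong simp: ennreal_mult' [symmetric] k h0)
  also have "\<dots> = (\<integral>\<^sup>+u. \<integral>\<^sup>+w. ennreal (h x u) * ennreal (h (x + y) w * exp (- (1 + u) * w)) \<partial>lborel \<partial>lborel)"
  proof (rule nn_integral_cong)
    fix u
    show "ennreal (h x u) * ennreal (Gamma (x + y) / (1 + u) powr (x + y)) =
       (\<integral>\<^sup>+w. ennreal (h x u) * ennreal (h (x + y) w * exp (- (1 + u) * w)) \<partial>lborel)"
    proof (cases "u > 0")
      case True
      have "ennreal (Gamma (x + y) / (1 + u) powr (x + y)) = (\<integral>\<^sup>+w. ennreal (h (x + y) w * exp (- (1 + u) * w)) \<partial>lborel)"
        using True assms by (simp only: *)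
      then show ?thesis by (subst nn_integral_cmult) auto
    qed (simp add: h_def)
  qed
  also have "\<dots> = (\<integral>\<^sup>+w. \<integral>\<^sup>+u. ennreal (h x u) * ennreal (h (x + y) w * exp (- (1 + u) * w)) \<partial>lborel \<partial>lborel)"
    by (rule lborel_pair.Fubini') measurable
  also have "\<dots> = (\<integral>\<^sup>+w. ennreal (Gamma x) * ennreal (h y w * exp (- 1 * w)) \<partial>lborel)"
  proof (rule nn_integral_cong)
    fix w
    show "(\<integral>\<^sup>+u. ennreal (h x u) * ennreal (h (x + y) w * exp (- (1 + u) * w)) \<partial>lborel) = ennreal (Gamma x) * ennreal (h y w * exp (- 1 * w))"
    proof (cases "w > 0")
      case True
      have "(\<integral>\<^sup>+u. ennreal (h x u) * ennreal (h (x + y) w * exp (- (1 + u) * w)) \<partial>lborel) =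
         (\<integral>\<^sup>+u. ennreal (h (x + y) w * exp (- w)) * ennreal (h x u * exp (- w * u)) \<partial>lborel)"
        by (intro nn_integral_cong) (auto simp: h0 ennreal_mult' [symmetric] exp_add [symmetric] field_simps exp_minus)
      also have "\<dots> = ennreal (h (x + y) w * exp (- w)) * ennreal (Gamma x / w powr x)"
        by (subst nn_integral_cmult, measurable) (use assms True in \<open>simp only: *\<close>)
      also have "\<dots> = ennreal (Gamma x) * ennreal (h y w * exp (- 1 * w))"
      proof -
        have "w powr (x + y - 1) = w powr x * w powr (y - 1)"
          by (simp flip: powr_add add: algebra_simps)
        then show ?thesis using True G by (simp add: h_def ennreal_mult' [symmetric])
      qed
      finally show ?thesis .
    qed (simp add: h_def)
  qed
  also have "\<dots> = ennreal (Gamma x) * ennreal (Gamma y)"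
    using *[of y 1] assms by (subst nn_integral_cmult) auto
  finally have **: "ennreal (Gamma (x + y)) * (\<integral>\<^sup>+u. ennreal (beta_prime_kernel x y u) \<partial>lborel) = \<dots>" .
  have "ennreal (Beta x y) = ennreal (inverse (Gamma (x + y))) * (ennreal (Gamma x) * ennreal (Gamma y))"
    using G by (simp add: Beta_def ennreal_mult' [symmetric] field_simps)
  also have "\<dots> = (\<integral>\<^sup>+u. ennreal (beta_prime_kernel x y u) \<partial>lborel)"
    using G by (simp only: **[symmetric] mult.assoc [symmetric]) (simp add: ennreal_mult' [symmetric])
  finally show ?thesis by simp
qed

text \<open>The integrand is even, and on the half-line the substitution \<open>t = w^2 / 2\<close>
  carries the integrand of \<open>Gamma ((b + 1) / 2)\<close> to a multiple of it.\<close>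

lemma nn_integral_std_normal_abs_powr:
  fixes b :: real
  assumes b: "b > -1"
  shows "(\<integral>\<^sup>+w. ennreal (std_normal_density w * \<bar>w\<bar> powr b) \<partial>lborel) =
    ennreal (2 powr (b / 2) * Gamma ((b + 1) / 2) / sqrt pi)"
proof -
  define f where "f t = t powr ((b + 1) / 2 - 1) / exp t" for t :: real
  have "(f has_integral Gamma ((b + 1) / 2)) {0..}"
    unfolding f_def using b by (intro Gamma_integral_real) auto
  moreover have im: "(\<lambda>w. w\<^sup>2 / 2) ` {0..} = {0::real..}"
  proof (intro equalityI subsetI)
    fix t :: real assume "t \<in> {0..}"
    then show "t \<in> (\<lambda>w. w\<^sup>2 / 2) ` {0..}" by (intro image_eqI[of _ _ "sqrt (2 * t)"]) auto
  qed auto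
  ultimately have "f absolutely_integrable_on (\<lambda>w. w\<^sup>2 / 2) ` {0..} \<and> integral ((\<lambda>w. w\<^sup>2 / 2) ` {0..}) f = Gamma ((b + 1) / 2)"
    unfolding im by (auto simp: has_integral_iff f_def intro!: nonnegative_absolutely_integrable_1)
  moreover have "inj_on (\<lambda>w. w\<^sup>2 / 2) {0::real..}"
    by (auto simp: inj_on_def)
  moreover have "((\<lambda>w. w\<^sup>2 / 2) has_field_derivative w) (at w within {0..})" for w :: real
    by (auto intro!: derivative_eq_intros)
  ultimately have "(\<lambda>w. \<bar>w\<bar> * f (w\<^sup>2 / 2)) absolutely_integrable_on {0..} \<and> integral {0..} (\<lambda>w. \<bar>w\<bar> * f (w\<^sup>2 / 2)) = Gamma ((b + 1) / 2)"
    by (subst has_absolute_integral_change_of_variables_1'[where g = "\<lambda>w. w\<^sup>2 / 2"]) auto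
  then have "((\<lambda>w. \<bar>w\<bar> * f (w\<^sup>2 / 2)) has_integral Gamma ((b + 1) / 2)) {0..}"
    by (auto simp: has_integral_iff dest: set_lebesgue_integral_eq_integral)
  then have *: "(\<integral>\<^sup>+w. ennreal (indicator {0..} w * (\<bar>w\<bar> * f (w\<^sup>2 / 2))) \<partial>lborel) = ennreal (Gamma ((b + 1) / 2))"
    by (intro nn_integral_has_integral_lebesgue) (auto simp: f_def)
  define g where "g w = std_normal_density w * \<bar>w\<bar> powr b" for w :: real
  \<comment> \<open>\<open>C\<close> compensates the denominator \<open>2 powr ((b - 1) / 2)\<close>
    left by the power of \<open>w^2 / 2\<close> and contains the normalisation
    \<open>1 / sqrt (2 * pi)\<close> of the normal density.\<close>
  define C where "C = 2 powr ((b - 1) / 2) / sqrt (2 * pi)"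
  have C: "C > 0" by (simp add: C_def)
  have gf: "g w = C * (\<bar>w\<bar> * f (w\<^sup>2 / 2))" for w
  proof (cases "w = 0")
    case False
    have "(w\<^sup>2 / 2) powr ((b + 1) / 2 - 1) = \<bar>w\<bar> powr (b - 1) / 2 powr ((b - 1) / 2)"
    proof -
      have "w\<^sup>2 = \<bar>w\<bar> powr 2" using False by simp
      then have "(w\<^sup>2 / 2) powr ((b - 1) / 2) = \<bar>w\<bar> powr (b - 1) / 2 powr ((b - 1) / 2)"
        by (simp only: powr_divide powr_powr) (simp add: diff_divide_distrib)
      moreover have "(b + 1) / 2 - 1 = (b - 1) / 2" by (simp add: field_simps)
      ultimately show ?thesis by simp
    qed
    moreover have "\<bar>w\<bar> * \<bar>w\<bar> powr (b - 1) = \<bar>w\<bar> powr b"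
      using False by (simp add: powr_mult_base)
    ultimately show ?thesis
      by (simp add: g_def C_def f_def std_normal_density_def exp_minus field_simps)
  qed (simp add: g_def)
  have [measurable]: "g \<in> borel_measurable borel" unfolding g_def by measurable
  have half: "(\<integral>\<^sup>+w. ennreal (indicator {0..} w * g w) \<partial>lborel) = ennreal (C * Gamma ((b + 1) / 2))"
  proof -
    have "(\<integral>\<^sup>+w. ennreal (indicator {0..} w * g w) \<partial>lborel) =
       (\<integral>\<^sup>+w. ennreal C * ennreal (indicator {0..} w * (\<bar>w\<bar> * f (w\<^sup>2 / 2))) \<partial>lborel)"
      using C by (intro nn_integral_cong) (simp add: gf ennreal_mult' [symmetric] mult_ac)
    also have "\<dots> = ennreal (C * Gamma ((b + 1) / 2))"
      using C by (subst nn_integral_cmult) (simp_all only: *, auto simp: ennreal_mult' f_def)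
    finally show ?thesis .
  qed
  \<comment> \<open>The two closed half-lines share the point 0, which is harmless because
    \<open>g 0 = 0\<close> by the convention \<open>0 powr b = 0\<close>.\<close>
  have "(\<integral>\<^sup>+w. ennreal (g w) \<partial>lborel) =
     (\<integral>\<^sup>+w. ennreal (indicator {0..} w * g w) + ennreal (indicator {..0} w * g w) \<partial>lborel)"
    by (intro nn_integral_cong) (auto simp: indicator_def g_def)
  also have "\<dots> = (\<integral>\<^sup>+w. ennreal (indicator {0..} w * g w) \<partial>lborel) + (\<integral>\<^sup>+w. ennreal (indicator {..0} w * g w) \<partial>lborel)"
    by (rule nn_integral_add) auto
  also have "(\<integral>\<^sup>+w. ennreal (indicator {..0} w * g w) \<partial>lborel) = (\<integral>\<^sup>+w. ennreal (indicator {0..} w * g w) \<partial>lborel)"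
    by (subst nn_integral_real_affine[where c = "-1" and t = 0])
      (auto intro!: nn_integral_cong simp: indicator_def g_def std_normal_density_def)
  also have "(\<integral>\<^sup>+w. ennreal (indicator {0..} w * g w) \<partial>lborel) + (\<integral>\<^sup>+w. ennreal (indicator {0..} w * g w) \<partial>lborel) = ennreal (2 * (C * Gamma ((b + 1) / 2)))"
    using C b by (simp add: half ennreal_plus [symmetric] Gamma_real_nonneg del: ennreal_plus)
  also have "2 * (C * Gamma ((b + 1) / 2)) = 2 powr (b / 2) * Gamma ((b + 1) / 2) / sqrt pi"
  proof -
    have "2 powr (b / 2) = 2 powr ((b - 1) / 2) * sqrt 2"
      by (simp add: powr_half_sqrt [symmetric] powr_add [symmetric] add_divide_distrib [symmetric])
    moreover have "sqrt 2 * (sqrt 2 * z) = 2 * z" for z :: real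
      by (simp add: mult.assoc [symmetric])
    ultimately show ?thesis by (simp add: C_def real_sqrt_mult field_simps)
  qed
  finally show ?thesis by (simp add: g_def)
qed

text \<open>Complete the square in \<open>x\<close>; the factor \<open>\<bar>y\<bar>\<^sup>b\<close> then only sees a rescaled variance.\<close>

lemma nn_integral_binormal_exp_powr:
  fixes u b \<rho> :: real
  assumes u: "u \<ge> 0" and \<rho>: "\<bar>\<rho>\<bar> < 1"
  shows "(\<integral>\<^sup>+y. \<integral>\<^sup>+x. ennreal (binormal_density \<rho> x y) * ennreal (exp (- u * x\<^sup>2) * \<bar>y\<bar> powr b) \<partial>lborel \<partial>lborel) =
    ennreal ((1 + 2 * u) powr (- 1 / 2) * (1 - \<rho>\<^sup>2 * (2 * u / (1 + 2 * u))) powr (b / 2)) *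
    (\<integral>\<^sup>+w. ennreal (std_normal_density w * \<bar>w\<bar> powr b) \<partial>lborel)"
proof -
  define q where "q = 1 - \<rho>\<^sup>2"
  have q: "q > 0" using \<rho> by (simp add: q_def abs_square_less_1)
  \<comment> \<open>The weight \<open>exp (- u * x^2)\<close> changes the coefficient of
    \<open>x^2\<close> in the exponent from \<open>1 / (2 * q)\<close> to
    \<open>v / (2 * q)\<close>. For fixed \<open>y\<close> the result is, up to a factor, a normal
    density in \<open>x\<close> with mean \<open>\<rho> * y / v\<close> and variance
    \<open>q / v\<close>.\<close>
  define v where "v = 1 + 2 * u * q"
  define t where "t = 1 + 2 * u"
  have t: "t \<ge> 1" using u by (simp add: t_def)
  have "u * q \<ge> 0" using u q by simp
  then have v: "v > 0" by (simp add: v_def)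
  have vt: "v - \<rho>\<^sup>2 = t * q" by (simp add: v_def t_def q_def algebra_simps)
  \<comment> \<open>What remains in \<open>y\<close> after completing the square:
    \<open>t powr (- 1 / 2)\<close> times the centered normal density of variance
    \<open>v / t\<close>.\<close>
  define r where "r y = exp (- (y\<^sup>2 * t) / (2 * v)) / sqrt (2 * pi * v)" for y
  have r0: "r y \<ge> 0" for y using v by (simp add: r_def)
  have [measurable]: "r \<in> borel_measurable borel" unfolding r_def by measurable
  have split: "binormal_density \<rho> x y * exp (- u * x\<^sup>2) = normal_density (\<rho> * y / v) (sqrt (q / v)) x * r y" for x y
  proof -
    have "- (x - \<rho> * y / v)\<^sup>2 / (2 * (q / v)) + - (y\<^sup>2 * t) / (2 * v) =
        - (v * (x - \<rho> * y / v)\<^sup>2 + y\<^sup>2 * (t * q) / v) / (2 * q)"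
      using v q by (simp add: field_simps)
    also have "v * (x - \<rho> * y / v)\<^sup>2 + y\<^sup>2 * (t * q) / v = v * x\<^sup>2 - 2 * \<rho> * x * y + y\<^sup>2"
      unfolding vt [symmetric] using v by (simp add: field_simps power2_eq_square)
    also have "- (v * x\<^sup>2 - 2 * \<rho> * x * y + y\<^sup>2) / (2 * q) = - (x\<^sup>2 - 2 * \<rho> * x * y + y\<^sup>2) / (2 * q) + - u * x\<^sup>2"
      using q by (simp add: v_def field_simps)
    finally have e: "- (x - \<rho> * y / v)\<^sup>2 / (2 * (q / v)) + - (y\<^sup>2 * t) / (2 * v) = \<dots>" .
    have "sqrt (2 * pi * (q / v)) * sqrt (2 * pi * v) = sqrt ((2 * pi)\<^sup>2 * q)"
      using v by (simp add: real_sqrt_mult [symmetric] power2_eq_square)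
    also have "\<dots> = 2 * pi * sqrt q" by (simp add: real_sqrt_mult)
    finally have s: "sqrt (2 * pi * (q / v)) * sqrt (2 * pi * v) = 2 * pi * sqrt q" .
    have "normal_density (\<rho> * y / v) (sqrt (q / v)) x * r y =
       exp (- (x - \<rho> * y / v)\<^sup>2 / (2 * (q / v)) + - (y\<^sup>2 * t) / (2 * v)) / (sqrt (2 * pi * (q / v)) * sqrt (2 * pi * v))"
      using q v by (simp only: normal_density_def r_def exp_add) (simp add: divide_nonneg_pos)
    also have "\<dots> = binormal_density \<rho> x y * exp (- u * x\<^sup>2)"
      unfolding e s by (simp only: exp_add binormal_density_def q_def times_divide_eq_left)
    finally show ?thesis by simp
  qed
  have "(\<integral>\<^sup>+y. \<integral>\<^sup>+x. ennreal (binormal_density \<rho> x y) * ennreal (exp (- u * x\<^sup>2) * \<bar>y\<bar> powr b) \<partial>lborel \<partial>lborel) =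
    (\<integral>\<^sup>+y. \<integral>\<^sup>+x. ennreal (normal_density (\<rho> * y / v) (sqrt (q / v)) x) * ennreal (r y * \<bar>y\<bar> powr b) \<partial>lborel \<partial>lborel)"
    using binormal_density_nonneg[OF \<rho>] r0
    by (intro nn_integral_cong) (simp add: ennreal_mult' [symmetric] split [unfolded mult_minus_left] mult.assoc [symmetric])
  also have "\<dots> = (\<integral>\<^sup>+y. ennreal (r y * \<bar>y\<bar> powr b) \<partial>lborel)"
  proof (intro nn_integral_cong)
    fix y
    have "(\<integral>\<^sup>+x. ennreal (normal_density (\<rho> * y / v) (sqrt (q / v)) x) \<partial>lborel) = 1"
      using q v by (subst nn_integral_eq_integral) (auto intro!: integrable_normal_density)
    then show "(\<integral>\<^sup>+x. ennreal (normal_density (\<rho> * y / v) (sqrt (q / v)) x) * ennreal (r y * \<bar>y\<bar> powr b) \<partial>lborel) = ennreal (r y * \<bar>y\<bar> powr b)"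
      by (subst nn_integral_multc) auto
  qed
  also have "\<dots> = ennreal (sqrt (v / t)) * (\<integral>\<^sup>+y. ennreal (r (sqrt (v / t) * y) * \<bar>sqrt (v / t) * y\<bar> powr b) \<partial>lborel)"
    using v t by (subst nn_integral_real_affine[where c = "sqrt (v / t)" and t = 0]) auto
  also have "\<dots> = ennreal (sqrt (v / t)) * (\<integral>\<^sup>+y. ennreal (sqrt (v / t) powr b / sqrt v) * ennreal (std_normal_density y * \<bar>y\<bar> powr b) \<partial>lborel)"
  proof (intro arg_cong2[where f = "(*)"] nn_integral_cong refl)
    fix y
    have rr: "r (sqrt (v / t) * y) = std_normal_density y / sqrt v"
      using v t by (simp add: r_def std_normal_density_def power_mult_distrib real_sqrt_mult)
    show "ennreal (r (sqrt (v / t) * y) * \<bar>sqrt (v / t) * y\<bar> powr b) = ennreal (sqrt (v / t) powr b / sqrt v) * ennreal (std_normal_density y * \<bar>y\<bar> powr b)"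
      unfolding rr using v t by (simp add: ennreal_mult' [symmetric] abs_mult powr_mult mult_ac)
  qed
  also have "\<dots> = ennreal (sqrt (v / t) * (sqrt (v / t) powr b / sqrt v)) * (\<integral>\<^sup>+w. ennreal (std_normal_density w * \<bar>w\<bar> powr b) \<partial>lborel)"
    using v t by (subst nn_integral_cmult, measurable) (simp add: mult.assoc [symmetric] ennreal_mult' [symmetric])
  also have "sqrt (v / t) * (sqrt (v / t) powr b / sqrt v) = t powr (- 1 / 2) * (v / t) powr (b / 2)"
  proof -
    have "sqrt (v / t) powr b = (v / t) powr (b / 2)"
      using v t by (simp add: powr_half_sqrt [symmetric] powr_powr del: real_sqrt_divide)
    moreover have "sqrt (v / t) / sqrt v = t powr (- 1 / 2)"
      using v t by (simp add: powr_half_sqrt [symmetric] powr_minus_divide real_sqrt_divide powr_divide)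
    ultimately show ?thesis by (metis mult.commute times_divide_eq_left times_divide_eq_right)
  qed
  also have "v / t = 1 - \<rho>\<^sup>2 * (2 * u / (1 + 2 * u))"
    using t by (simp add: v_def t_def q_def field_simps)
  finally show ?thesis by (simp add: t_def)
qed

text \<open>The law of a variable \<open>U\<close> for which \<open>U / (1 + U)\<close> has the Beta
  distribution with parameters \<open>x\<close> and \<open>y\<close>.\<close>

definition beta_prime :: "real \<Rightarrow> real \<Rightarrow> real measure" where
  "beta_prime x y = density lborel (\<lambda>u. ennreal (beta_prime_kernel x y u / Beta x y))"

lemma sets_beta_prime [measurable_cong, simp]: "sets (beta_prime x y) = sets borel"
  by (simp add: beta_prime_def)

lemma space_beta_prime [simp]: "space (beta_prime x y) = UNIV"
  by (simp add: beta_prime_def)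

lemma Beta_real_pos: "x > 0 \<Longrightarrow> y > 0 \<Longrightarrow> Beta x y > (0 :: real)"
  by (simp add: Beta_def Gamma_real_pos)

lemma prob_space_beta_prime:
  assumes "x > 0" "y > 0"
  shows "prob_space (beta_prime x y)"
proof
  have "(\<integral>\<^sup>+u. ennreal (beta_prime_kernel x y u / Beta x y) \<partial>lborel) =
      (\<integral>\<^sup>+u. ennreal (inverse (Beta x y)) * ennreal (beta_prime_kernel x y u) \<partial>lborel)"
    using Beta_real_pos[OF assms] beta_prime_kernel_nonneg
    by (intro nn_integral_cong) (simp add: ennreal_mult' [symmetric] field_simps)
  also have "\<dots> = 1"
    using Beta_real_pos[OF assms]
    by (subst nn_integral_cmult) (auto simp: nn_integral_beta_prime_kernel[OF assms] ennreal_mult' [symmetric])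
  finally show "emeasure (beta_prime x y) (space (beta_prime x y)) = 1"
    by (simp add: beta_prime_def emeasure_density)
qed

lemma AE_beta_prime_pos: "AE u in beta_prime x y. u > 0"
  unfolding beta_prime_def by (subst AE_density) (auto simp: beta_prime_kernel_def indicator_def)

lemma nn_integral_beta_prime:
  assumes "x > 0" "y > 0" and [measurable]: "g \<in> borel_measurable borel"
  shows "(\<integral>\<^sup>+u. ennreal (beta_prime_kernel x y u) * g u \<partial>lborel) =
    ennreal (Beta x y) * (\<integral>\<^sup>+u. g u \<partial>beta_prime x y)"
proof -
  have "(\<integral>\<^sup>+u. ennreal (beta_prime_kernel x y u) * g u \<partial>lborel) =
      (\<integral>\<^sup>+u. ennreal (Beta x y) * (ennreal (beta_prime_kernel x y u / Beta x y) * g u) \<partial>lborel)"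
    using Beta_real_pos[OF assms(1,2)]
    by (intro nn_integral_cong) (simp add: mult.assoc [symmetric] ennreal_mult' [symmetric])
  then show ?thesis
    unfolding beta_prime_def by (simp add: nn_integral_cmult nn_integral_density)
qed

section \<open>Absolute moments of a correlated pair of standard normal variables\<close>

definition normal_abs_moment :: "real \<Rightarrow> real" where
  "normal_abs_moment b = 2 powr (b / 2) * Gamma ((b + 1) / 2) / sqrt pi"

lemma normal_abs_moment_pos: "b > -1 \<Longrightarrow> normal_abs_moment b > 0"
  by (simp add: normal_abs_moment_def Gamma_real_pos)

lemma nn_integral_binormal_snd:
  assumes "\<bar>\<rho>\<bar> < 1" "b > -1"
  shows "(\<integral>\<^sup>+y. \<integral>\<^sup>+x. ennreal (binormal_density \<rho> x y) * ennreal (\<bar>y\<bar> powr b) \<partial>lborel \<partial>lborel) = ennreal (normal_abs_moment b)"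
  using nn_integral_binormal_exp_powr[of 0 \<rho> b] assms
  by (simp add: nn_integral_std_normal_abs_powr normal_abs_moment_def)

lemma nn_integral_binormal_fst:
  assumes "\<bar>\<rho>\<bar> < 1" "b > -1"
  shows "(\<integral>\<^sup>+y. \<integral>\<^sup>+x. ennreal (binormal_density \<rho> x y) * ennreal (\<bar>x\<bar> powr b) \<partial>lborel \<partial>lborel) = ennreal (normal_abs_moment b)"
proof -
  have "(\<integral>\<^sup>+y. \<integral>\<^sup>+x. ennreal (binormal_density \<rho> x y) * ennreal (\<bar>x\<bar> powr b) \<partial>lborel \<partial>lborel) =
     (\<integral>\<^sup>+x. \<integral>\<^sup>+y. ennreal (binormal_density \<rho> x y) * ennreal (\<bar>x\<bar> powr b) \<partial>lborel \<partial>lborel)"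
    by (rule lborel_pair.Fubini') (simp add: split_beta' binormal_density_def)
  also have "\<dots> = (\<integral>\<^sup>+x. \<integral>\<^sup>+y. ennreal (binormal_density \<rho> y x) * ennreal (\<bar>x\<bar> powr b) \<partial>lborel \<partial>lborel)"
    by (intro nn_integral_cong) (simp add: binormal_density_def algebra_simps)
  finally show ?thesis using nn_integral_binormal_snd[OF assms] by simp
qed

text \<open>Represent \<open>(x^2) powr - (s / 2)\<close> as a Laplace integral over
  \<open>u\<close> and let Tonelli move that integral outside. At fixed \<open>u\<close> the
  Gaussian integral is the completed-square formula, and the remaining weight in \<open>u\<close>
  is, up to scaling, a beta prime kernel.\<close>

lemma nn_integral_binormal_powr_powr:
  fixes s b \<rho> :: real
  assumes s: "0 < s" "s < 1" and b: "b > -1" and \<rho>: "\<bar>\<rho>\<bar> < 1"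
  shows "(\<integral>\<^sup>+y. \<integral>\<^sup>+x. ennreal (binormal_density \<rho> x y) * ennreal (\<bar>x\<bar> powr - s * \<bar>y\<bar> powr b) \<partial>lborel \<partial>lborel) =
    ennreal (normal_abs_moment (- s) * normal_abs_moment b) *
    (\<integral>\<^sup>+u. ennreal ((1 - \<rho>\<^sup>2 * (u / (1 + u))) powr (b / 2)) \<partial>beta_prime (s / 2) ((1 - s) / 2))"
proof -
  define h where "h u = indicator {0<..} u * u powr (s / 2 - 1)" for u :: real
  have h0: "h u \<ge> 0" for u by (simp add: h_def)
  have [measurable]: "h \<in> borel_measurable borel" unfolding h_def by measurable
  note q0 = binormal_density_nonneg[OF \<rho>]
  have G: "Gamma (s / 2) > 0" "Gamma ((1 - s) / 2) > 0" using s by (auto intro!: Gamma_real_pos)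
  let ?q = "\<lambda>x y. ennreal (binormal_density \<rho> x y)"
  let ?M = "ennreal (normal_abs_moment b)"
  define r where "r w = (1 - \<rho>\<^sup>2 * w) powr (b / 2)" for w
  have r0: "r w \<ge> 0" for w by (simp add: r_def)
  have [measurable]: "r \<in> borel_measurable borel" unfolding r_def by measurable
  have "ennreal (Gamma (s / 2)) * (\<integral>\<^sup>+y. \<integral>\<^sup>+x. ?q x y * ennreal (\<bar>x\<bar> powr - s * \<bar>y\<bar> powr b) \<partial>lborel \<partial>lborel) =
     (\<integral>\<^sup>+y. \<integral>\<^sup>+x. ennreal (Gamma (s / 2)) * (?q x y * ennreal (\<bar>x\<bar> powr - s * \<bar>y\<bar> powr b)) \<partial>lborel \<partial>lborel)"
    by (simp add: nn_integral_cmult)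
  also have "\<dots> = (\<integral>\<^sup>+y. \<integral>\<^sup>+x. \<integral>\<^sup>+u. ennreal (h u) * (?q x y * ennreal (exp (- u * x\<^sup>2) * \<bar>y\<bar> powr b)) \<partial>lborel \<partial>lborel \<partial>lborel)"
    \<comment> \<open>only almost everywhere: at \<open>x = 0\<close> the left side is \<open>0\<close>, since \<open>0 powr - s = 0\<close>\<close>
  proof (rule nn_integral_cong, rule nn_integral_cong_AE, rule eventually_mono[OF AE_lborel_singleton[of 0]])
    fix y x :: real assume x: "x \<noteq> 0"
    have "x\<^sup>2 = \<bar>x\<bar> powr 2" using x by simp
    then have "(x\<^sup>2) powr (s / 2) = \<bar>x\<bar> powr s" by (simp only: powr_powr) simp
    then have "ennreal (Gamma (s / 2)) * (?q x y * ennreal (\<bar>x\<bar> powr - s * \<bar>y\<bar> powr b)) =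
        (?q x y * ennreal (\<bar>y\<bar> powr b)) * ennreal (Gamma (s / 2) / (x\<^sup>2) powr (s / 2))"
      using q0 G by (simp add: ennreal_mult' [symmetric] powr_minus field_simps)
    also have "ennreal (Gamma (s / 2) / (x\<^sup>2) powr (s / 2)) = (\<integral>\<^sup>+u. ennreal (h u * exp (- x\<^sup>2 * u)) \<partial>lborel)"
      using nn_integral_powr_exp[of "s / 2" "x\<^sup>2"] s x by (simp add: h_def)
    also have "(?q x y * ennreal (\<bar>y\<bar> powr b)) * \<dots> =
        (\<integral>\<^sup>+u. (?q x y * ennreal (\<bar>y\<bar> powr b)) * ennreal (h u * exp (- x\<^sup>2 * u)) \<partial>lborel)"
      by (subst nn_integral_cmult) auto
    also have "\<dots> = (\<integral>\<^sup>+u. ennreal (h u) * (?q x y * ennreal (exp (- u * x\<^sup>2) * \<bar>y\<bar> powr b)) \<partial>lborel)"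
      using q0 h0 by (intro nn_integral_cong) (simp add: ennreal_mult' [symmetric] mult_ac)
    finally show "ennreal (Gamma (s / 2)) * (?q x y * ennreal (\<bar>x\<bar> powr - s * \<bar>y\<bar> powr b)) = \<dots>" .
  qed
  also have "\<dots> = (\<integral>\<^sup>+y. \<integral>\<^sup>+u. \<integral>\<^sup>+x. ennreal (h u) * (?q x y * ennreal (exp (- u * x\<^sup>2) * \<bar>y\<bar> powr b)) \<partial>lborel \<partial>lborel \<partial>lborel)"
    by (intro nn_integral_cong lborel_pair.Fubini') measurable
  also have "\<dots> = (\<integral>\<^sup>+u. \<integral>\<^sup>+y. \<integral>\<^sup>+x. ennreal (h u) * (?q x y * ennreal (exp (- u * x\<^sup>2) * \<bar>y\<bar> powr b)) \<partial>lborel \<partial>lborel \<partial>lborel)"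
    by (intro lborel_pair.Fubini') measurable
  also have "\<dots> = (\<integral>\<^sup>+u. ennreal (h u * (1 + 2 * u) powr (- 1 / 2) * r (2 * u / (1 + 2 * u))) * ?M \<partial>lborel)"
  proof (rule nn_integral_cong)
    fix u
    show "(\<integral>\<^sup>+y. \<integral>\<^sup>+x. ennreal (h u) * (?q x y * ennreal (exp (- u * x\<^sup>2) * \<bar>y\<bar> powr b)) \<partial>lborel \<partial>lborel)
       = ennreal (h u * (1 + 2 * u) powr (- 1 / 2) * r (2 * u / (1 + 2 * u))) * ?M"
    proof (cases "u > 0")
      case True
      have "(\<integral>\<^sup>+y. \<integral>\<^sup>+x. ennreal (h u) * (?q x y * ennreal (exp (- u * x\<^sup>2) * \<bar>y\<bar> powr b)) \<partial>lborel \<partial>lborel) =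
        ennreal (h u) * (\<integral>\<^sup>+y. \<integral>\<^sup>+x. ?q x y * ennreal (exp (- u * x\<^sup>2) * \<bar>y\<bar> powr b) \<partial>lborel \<partial>lborel)"
        by (simp add: nn_integral_cmult)
      also have "\<dots> = ennreal (h u) * (ennreal ((1 + 2 * u) powr (- 1 / 2) * r (2 * u / (1 + 2 * u))) * ?M)"
        using True b by (subst nn_integral_binormal_exp_powr[OF _ \<rho>])
          (simp_all add: r_def nn_integral_std_normal_abs_powr normal_abs_moment_def)
      finally show ?thesis using h0 r0 by (simp add: ennreal_mult mult.assoc)
    qed (simp add: h_def)
  qed
  \<comment> \<open>Replacing \<open>u\<close> by \<open>u / 2\<close> turns
    \<open>2 * u / (1 + 2 * u)\<close> into \<open>u / (1 + u)\<close>.\<close>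
  also have "\<dots> = ennreal (1 / 2) * (\<integral>\<^sup>+u. ennreal (h (u / 2) * (1 + u) powr (- 1 / 2) * r (u / (1 + u))) * ?M \<partial>lborel)"
    by (subst nn_integral_real_affine[where c = "1 / 2" and t = 0]) auto
  also have "\<dots> = ennreal (1 / 2) * (\<integral>\<^sup>+u. (ennreal (2 powr (1 - s / 2)) * ?M) * (ennreal (beta_prime_kernel (s / 2) ((1 - s) / 2) u) * ennreal (r (u / (1 + u)))) \<partial>lborel)"
  proof (rule arg_cong2[where f = "(*)", OF refl], rule nn_integral_cong)
    fix u
    \<comment> \<open>The two parameters add up to \<open>1 / 2\<close>, so the power of
      \<open>1 + u\<close> coming from the Gaussian integral is exactly that of the kernel.\<close>
    have e: "- (s / 2 + (1 - s) / 2) = - 1 / 2" by (simp add: field_simps)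
    have "h (u / 2) = 2 powr (1 - s / 2) * (indicator {0<..} u * u powr (s / 2 - 1))"
    proof -
      have "(2::real) powr (1 - s / 2) = 1 / 2 powr (s / 2 - 1)"
        by (simp flip: powr_minus_divide)
      then show ?thesis by (simp add: h_def powr_divide indicator_def)
    qed
    then have "h (u / 2) * (1 + u) powr (- 1 / 2) = 2 powr (1 - s / 2) * beta_prime_kernel (s / 2) ((1 - s) / 2) u"
      unfolding beta_prime_kernel_def e by (simp only: mult.assoc)
    then show "ennreal (h (u / 2) * (1 + u) powr (- 1 / 2) * r (u / (1 + u))) * ?M =
       (ennreal (2 powr (1 - s / 2)) * ?M) * (ennreal (beta_prime_kernel (s / 2) ((1 - s) / 2) u) * ennreal (r (u / (1 + u))))"
      using r0 beta_prime_kernel_nonneg by (simp add: ennreal_mult mult_ac)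
  qed
  also have "\<dots> = (ennreal (1 / 2) * ennreal (2 powr (1 - s / 2)) * ?M) * (\<integral>\<^sup>+u. ennreal (beta_prime_kernel (s / 2) ((1 - s) / 2) u) * ennreal (r (u / (1 + u))) \<partial>lborel)"
    by (subst nn_integral_cmult) (simp_all add: mult.assoc)
  also have "\<dots> = (ennreal (1 / 2) * ennreal (2 powr (1 - s / 2)) * ?M) * (ennreal (Beta (s / 2) ((1 - s) / 2)) * (\<integral>\<^sup>+u. ennreal (r (u / (1 + u))) \<partial>beta_prime (s / 2) ((1 - s) / 2)))"
    using s by (subst nn_integral_beta_prime) auto
  also have "\<dots> = ennreal (1 / 2 * 2 powr (1 - s / 2) * normal_abs_moment b * Beta (s / 2) ((1 - s) / 2)) * (\<integral>\<^sup>+u. ennreal (r (u / (1 + u))) \<partial>beta_prime (s / 2) ((1 - s) / 2))"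
  proof -
    have *: "ennreal k1 * ennreal k2 * ennreal k3 * (ennreal k4 * I) = ennreal (k1 * k2 * k3 * k4) * I"
      if "k1 \<ge> 0" "k2 \<ge> 0" "k3 \<ge> 0" for k1 k2 k3 k4 :: real and I
      using that by (simp only: ennreal_mult' mult_nonneg_nonneg mult.assoc)
    show ?thesis by (rule *) (use normal_abs_moment_pos[OF b] in auto)
  qed
  \<comment> \<open>The denominator of the Beta value is \<open>Gamma (1 / 2) = sqrt pi\<close>, so
    its factor \<open>Gamma ((1 - s) / 2)\<close> and the power of 2 make up the moment of order
    \<open>- s\<close>. The factor \<open>Gamma (s / 2)\<close> cancels against the left
    side.\<close>
  also have "1 / 2 * 2 powr (1 - s / 2) * normal_abs_moment b * Beta (s / 2) ((1 - s) / 2) =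
     Gamma (s / 2) * (normal_abs_moment (- s) * normal_abs_moment b)"
  proof -
    have "1 / 2 * 2 powr (1 - s / 2) = 2 powr (- s / 2)"
      by (simp add: powr_diff powr_minus_divide)
    moreover have e: "s / 2 + (1 - s) / 2 = 1 / 2" by (simp add: field_simps)
    ultimately show ?thesis
      unfolding Beta_def normal_abs_moment_def [of "- s"] e by (simp add: Gamma_one_half_real mult_ac)
  qed
  finally have eq: "ennreal (Gamma (s / 2)) * (\<integral>\<^sup>+y. \<integral>\<^sup>+x. ?q x y * ennreal (\<bar>x\<bar> powr - s * \<bar>y\<bar> powr b) \<partial>lborel \<partial>lborel) =
     ennreal (Gamma (s / 2)) * (ennreal (normal_abs_moment (- s) * normal_abs_moment b) * (\<integral>\<^sup>+u. ennreal (r (u / (1 + u))) \<partial>beta_prime (s / 2) ((1 - s) / 2)))"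
    using G normal_abs_moment_pos[OF b] normal_abs_moment_pos[of "- s"] s
    by (simp only: ennreal_mult' [symmetric] ennreal_mult mult.assoc) (simp add: ennreal_mult mult.assoc)
  have "ennreal (Gamma (s / 2)) \<noteq> 0" "ennreal (Gamma (s / 2)) \<noteq> \<top>" using G by auto
  with eq show ?thesis by (simp add: ennreal_mult_cancel_left r_def)
qed

subsection \<open>Mixed moments of a bivariate Gaussian pair\<close>

lemma has_bochner_integral_std_gaussian:
  fixes f :: "real \<Rightarrow> real"
  assumes "has_bochner_integral lborel (\<lambda>x. std_normal_density x * f x) I"
    and [measurable]: "f \<in> borel_measurable borel"
  shows "has_bochner_integral std_gaussian f I"
  unfolding std_gaussian_def using assms by (intro has_bochner_integral_density) (auto simp: AE_I2)

lemma std_gaussian_moments: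
  "has_bochner_integral std_gaussian (\<lambda>x. x) 0" "has_bochner_integral std_gaussian (\<lambda>x. x\<^sup>2) 1"
  "has_bochner_integral std_gaussian (\<lambda>x. 1) (1 :: real)"
proof -
  show "has_bochner_integral std_gaussian (\<lambda>x. x) 0"
    using std_normal_moment_odd[of 0] by (intro has_bochner_integral_std_gaussian) auto
  show "has_bochner_integral std_gaussian (\<lambda>x. x\<^sup>2) 1"
    using std_normal_moment_even[of 1] by (intro has_bochner_integral_std_gaussian) auto
  show "has_bochner_integral std_gaussian (\<lambda>x. 1) (1 :: real)"
    using prob_space.prob_space[OF prob_space_std_gaussian]
    by (auto simp: has_bochner_integral_iff intro!: finite_measure.integrable_const prob_space.finite_measure prob_space_std_gaussian)
qed

lemma (in pair_sigma_finite) has_bochner_integral_pair_mult: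
  fixes f g :: "_ \<Rightarrow> real"
  assumes f: "has_bochner_integral M1 f I" and g: "has_bochner_integral M2 g J"
  shows "has_bochner_integral (M1 \<Otimes>\<^sub>M M2) (\<lambda>p. f (fst p) * g (snd p)) (I * J)"
proof -
  have if_: "integrable M1 f" "integral\<^sup>L M1 f = I" and ig: "integrable M2 g" "integral\<^sup>L M2 g = J"
    using f g by (auto simp: has_bochner_integral_iff)
  note [measurable] = borel_measurable_integrable[OF if_(1)] borel_measurable_integrable[OF ig(1)]
  have int: "integrable (M1 \<Otimes>\<^sub>M M2) (\<lambda>p. f (fst p) * g (snd p))"
    using if_ ig by (intro Fubini_integrable) (auto simp: abs_mult)
  then have "(\<integral>p. f (fst p) * g (snd p) \<partial>(M1 \<Otimes>\<^sub>M M2)) = I * J"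
    using if_ ig by (subst integral_fst' [symmetric]) auto
  with int show ?thesis by (simp add: has_bochner_integral_iff)
qed

text \<open>The means force the shift to vanish, and the second moments are the Gram entries of the
  two matrix rows. Dividing the rows by \<open>\<sigma>1\<close> and \<open>\<sigma>2\<close> gives
  unit vectors with inner product \<open>\<rho>\<close>, to which the density formula for linear
  images applies.\<close>

lemma bivariate_gaussian_nn_integral:
  fixes M :: "'a measure" and X1 X2 :: "'a \<Rightarrow> real"
  assumes "bivariate_gaussian M X1 X2"
    and mean: "(\<integral>\<omega>. X1 \<omega> \<partial>M) = 0" "(\<integral>\<omega>. X2 \<omega> \<partial>M) = 0"
    and \<sigma>: "\<sigma>1 > 0" "\<sigma>2 > 0"
    and var: "(\<integral>\<omega>. (X1 \<omega>)\<^sup>2 \<partial>M) = \<sigma>1\<^sup>2" "(\<integral>\<omega>. (X2 \<omega>)\<^sup>2 \<partial>M) = \<sigma>2\<^sup>2"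
    and cov: "\<rho> = (\<integral>\<omega>. X1 \<omega> * X2 \<omega> \<partial>M) / (\<sigma>1 * \<sigma>2)" and \<rho>: "\<bar>\<rho>\<bar> < 1"
    and [measurable]: "f \<in> borel_measurable (borel \<Otimes>\<^sub>M borel)"
  shows "(\<integral>\<^sup>+\<omega>. f (X1 \<omega>, X2 \<omega>) \<partial>M) =
    (\<integral>\<^sup>+y. \<integral>\<^sup>+x. ennreal (binormal_density \<rho> x y) * f (\<sigma>1 * x, \<sigma>2 * y) \<partial>lborel \<partial>lborel)"
proof -
  from assms(1) obtain \<mu>1 \<mu>2 a b c d where
    [measurable]: "X1 \<in> borel_measurable M" "X2 \<in> borel_measurable M" and
    eq: "distr M (borel \<Otimes>\<^sub>M borel) (\<lambda>\<omega>. (X1 \<omega>, X2 \<omega>)) =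
        distr (std_gaussian \<Otimes>\<^sub>M std_gaussian) (borel \<Otimes>\<^sub>M borel)
          (\<lambda>(z1, z2). (\<mu>1 + a * z1 + b * z2, \<mu>2 + c * z1 + d * z2))"
    unfolding bivariate_gaussian_def by blast
  interpret prob_space std_gaussian by (rule prob_space_std_gaussian)
  interpret P: pair_sigma_finite std_gaussian std_gaussian ..
  define P where "P = std_gaussian \<Otimes>\<^sub>M std_gaussian"
  have sP [measurable_cong]: "sets P = sets (borel \<Otimes>\<^sub>M borel)"
    unfolding P_def by (intro sets_pair_measure_cong) auto
  \<comment> \<open>The transfer asks for measurability only, so integrability of the variables and
    of their products need not be known beforehand.\<close>
  have tr: "(\<integral>\<omega>. g (X1 \<omega>, X2 \<omega>) \<partial>M) =
      (\<integral>p. g (\<mu>1 + a * fst p + b * snd p, \<mu>2 + c * fst p + d * snd p) \<partial>P)"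
    if [measurable]: "g \<in> borel_measurable (borel \<Otimes>\<^sub>M borel)" for g :: "real \<times> real \<Rightarrow> real"
  proof -
    have "(\<integral>\<omega>. g (X1 \<omega>, X2 \<omega>) \<partial>M) = integral\<^sup>L (distr M (borel \<Otimes>\<^sub>M borel) (\<lambda>\<omega>. (X1 \<omega>, X2 \<omega>))) g"
      by (subst integral_distr) auto
    also have "\<dots> = (\<integral>p. g (\<mu>1 + a * fst p + b * snd p, \<mu>2 + c * fst p + d * snd p) \<partial>P)"
      unfolding eq P_def by (subst integral_distr) (auto simp: split_beta')
    finally show ?thesis .
  qed
  note m = std_gaussian_moments
  have "has_bochner_integral P (\<lambda>p. fst p * 1) (0 * 1)" "has_bochner_integral P (\<lambda>p. 1 * snd p) (1 * 0)"
    "has_bochner_integral P (\<lambda>p. (fst p)\<^sup>2 * 1) (1 * 1)" "has_bochner_integral P (\<lambda>p. 1 * (snd p)\<^sup>2) (1 * 1)"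
    "has_bochner_integral P (\<lambda>p. fst p * snd p) (0 * 0)" "has_bochner_integral P (\<lambda>p. 1 * 1) (1 * 1 :: real)"
    unfolding P_def
    by (rule P.has_bochner_integral_pair_mult[OF m(1) m(3)] P.has_bochner_integral_pair_mult[OF m(3) m(1)]
      P.has_bochner_integral_pair_mult[OF m(2) m(3)] P.has_bochner_integral_pair_mult[OF m(3) m(2)]
      P.has_bochner_integral_pair_mult[OF m(1) m(1)] P.has_bochner_integral_pair_mult[OF m(3) m(3)])+
  then have hb: "has_bochner_integral P (\<lambda>p. fst p) 0" "has_bochner_integral P (\<lambda>p. snd p) 0"
    "has_bochner_integral P (\<lambda>p. (fst p)\<^sup>2) 1" "has_bochner_integral P (\<lambda>p. (snd p)\<^sup>2) 1"
    "has_bochner_integral P (\<lambda>p. fst p * snd p) 0" "has_bochner_integral P (\<lambda>p. 1 :: real) 1"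
    by simp_all
  have lin: "(\<integral>p. \<mu> + k * fst p + l * snd p \<partial>P) = \<mu>" for \<mu> k l
  proof -
    have "has_bochner_integral P (\<lambda>p. \<mu> * 1 + k * fst p + l * snd p) (\<mu> * 1 + k * 0 + l * 0)"
      by (intro has_bochner_integral_add has_bochner_integral_mult_right hb)
    then show ?thesis by (simp add: has_bochner_integral_iff)
  qed
  have bil: "(\<integral>p. (k * fst p + l * snd p) * (k' * fst p + l' * snd p) \<partial>P) = k * k' + l * l'" for k l k' l'
  proof -
    have "has_bochner_integral P (\<lambda>p. (k * k') * (fst p)\<^sup>2 + (l * l') * (snd p)\<^sup>2 + (k * l' + l * k') * (fst p * snd p))
       (k * k' * 1 + l * l' * 1 + (k * l' + l * k') * 0)"
      by (intro has_bochner_integral_add has_bochner_integral_mult_right hb)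
    moreover have "(k * fst p + l * snd p) * (k' * fst p + l' * snd p) =
      (k * k') * (fst p)\<^sup>2 + (l * l') * (snd p)\<^sup>2 + (k * l' + l * k') * (fst p * snd p)" for p :: "real \<times> real"
      by (simp add: power2_eq_square algebra_simps)
    ultimately show ?thesis by (simp add: has_bochner_integral_iff)
  qed
  have \<mu>: "\<mu>1 = 0" "\<mu>2 = 0"
    using tr[of fst] tr[of snd] mean by (simp_all add: lin)
  have rows: "a\<^sup>2 + b\<^sup>2 = \<sigma>1\<^sup>2" "c\<^sup>2 + d\<^sup>2 = \<sigma>2\<^sup>2" "a * c + b * d = \<rho> * (\<sigma>1 * \<sigma>2)"
    using tr[of "\<lambda>p. fst p * fst p"] tr[of "\<lambda>p. snd p * snd p"] tr[of "\<lambda>p. fst p * snd p"] var cov \<sigma>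
    by (simp_all add: \<mu> bil power2_eq_square)
  have "(\<integral>\<^sup>+\<omega>. f (X1 \<omega>, X2 \<omega>) \<partial>M) = (\<integral>\<^sup>+p. f p \<partial>distr M (borel \<Otimes>\<^sub>M borel) (\<lambda>\<omega>. (X1 \<omega>, X2 \<omega>)))"
    by (subst nn_integral_distr) auto
  also have "\<dots> = (\<integral>\<^sup>+p. f (a * fst p + b * snd p, c * fst p + d * snd p) \<partial>(std_gaussian \<Otimes>\<^sub>M std_gaussian))"
    unfolding eq by (subst nn_integral_distr) (auto simp: split_beta' \<mu>)
  also have "\<dots> = (\<integral>\<^sup>+p. (\<lambda>p. f (\<sigma>1 * fst p, \<sigma>2 * snd p)) (a / \<sigma>1 * fst p + b / \<sigma>1 * snd p, c / \<sigma>2 * fst p + d / \<sigma>2 * snd p)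
      \<partial>(std_gaussian \<Otimes>\<^sub>M std_gaussian))"
    using \<sigma> by (simp add: distrib_left)
  also have "\<dots> = (\<integral>\<^sup>+y. \<integral>\<^sup>+x. ennreal (binormal_density \<rho> x y) * f (\<sigma>1 * x, \<sigma>2 * y) \<partial>lborel \<partial>lborel)"
    by (subst nn_integral_std_gaussian_linear[where \<rho> = \<rho>])
      (use \<sigma> rows \<rho> in \<open>auto simp: power_divide add_divide_distrib [symmetric] field_simps\<close>)
  finally show ?thesis .
qed

subsection \<open>Euler's integral and Bernoulli's inequality\<close>

text \<open>The weighted inequality of arithmetic and geometric means for \<open>v\<close> and 1
  with weights \<open>p\<close> and \<open>1 - p\<close>.\<close>

lemma powr_le_Bernoulli:
  fixes v p :: real
  assumes "v > 0" "0 \<le> p" "p \<le> 1"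
  shows "v powr p \<le> 1 + p * (v - 1)"
  using Youngs_inequality_0[of p "1 - p" v 1] assms by (simp add: algebra_simps)

text \<open>The concave case with exponent \<open>1 / p\<close> at the point
  \<open>v powr p\<close>, solved for \<open>v powr p\<close>.\<close>

lemma powr_ge_Bernoulli:
  fixes v p :: real
  assumes "v > 0" "p \<ge> 1"
  shows "1 + p * (v - 1) \<le> v powr p"
proof -
  have "v \<le> 1 + 1 / p * (v powr p - 1)"
    using powr_le_Bernoulli[of "v powr p" "1 / p"] assms by (simp add: powr_powr)
  then show ?thesis using assms by (simp add: field_simps)
qed

text \<open>Both parts are Bernoulli's inequality at \<open>1 / (1 - w)\<close> multiplied through
  by \<open>(1 - w) powr p\<close>; the identity \<open>r\<close> in the proof rewrites the linear
  side.\<close>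

lemma powr_Bernoulli_inverse:
  fixes w p :: real
  assumes "w < 1"
  shows "0 \<le> p \<Longrightarrow> p \<le> 1 \<Longrightarrow> 1 - (1 - w) powr p \<le> p * w * (1 - w) powr (p - 1)"
    and "p \<ge> 1 \<Longrightarrow> p * w * (1 - w) powr (p - 1) \<le> 1 - (1 - w) powr p"
proof -
  have w: "1 - w > 0" using assms by simp
  have v: "(1 / (1 - w)) powr p * (1 - w) powr p = 1"
    using w by (simp add: powr_divide)
  have r: "(1 + p * (1 / (1 - w) - 1)) * (1 - w) powr p = (1 - w) powr p + p * w * (1 - w) powr (p - 1)"
  proof -
    have e: "(1 - w) powr p = (1 - w) powr (p - 1) * (1 - w)"
      using w by (simp add: powr_diff)
    show ?thesis unfolding e using w by (simp add: field_simps)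
  qed
  show "1 - (1 - w) powr p \<le> p * w * (1 - w) powr (p - 1)" if "0 \<le> p" "p \<le> 1"
    using mult_right_mono[OF powr_le_Bernoulli[of "1 / (1 - w)" p] powr_ge_zero[of "1 - w" p]] w that
    unfolding v r by simp
  show "p * w * (1 - w) powr (p - 1) \<le> 1 - (1 - w) powr p" if "p \<ge> 1"
    using mult_right_mono[OF powr_ge_Bernoulli[of "1 / (1 - w)" p] powr_ge_zero[of "1 - w" p]] w that
    unfolding v r by simp
qed

text \<open>With \<open>b\<^sub>n = (-q)\<^sub>n / n!\<close> the sum telescopes: \<open>q \<bar>b\<^sub>n\<bar> = n \<bar>b\<^sub>n\<bar> - (n + 1) \<bar>b\<^sub>n\<^sub>+\<^sub>1\<bar>\<close> once \<open>n \<ge> q\<close>.\<close>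

lemma summable_abs_pochhammer_neg:
  fixes q :: real
  assumes q: "q > 0"
  shows "summable (\<lambda>n. \<bar>pochhammer (- q) n / fact n\<bar>)"
proof -
  define b where "b n = \<bar>pochhammer (- q) n / fact n\<bar>" for n
  \<comment> \<open>From index \<open>N\<close> on, the new factor \<open>n - q\<close> is
    nonnegative, so absolute values satisfy the same recursion as the coefficients.\<close>
  define N where "N = nat \<lceil>q\<rceil>"
  have N: "real N \<ge> q" by (simp add: N_def) linarith
  have step: "q * b n = real n * b n - real (Suc n) * b (Suc n)" if "n \<ge> N" for n
  proof -
    have "real n - q \<ge> 0" using N that by linarith
    then have "\<bar>pochhammer (- q) (Suc n)\<bar> = \<bar>pochhammer (- q) n\<bar> * (real n - q)"
      by (simp add: pochhammer_Suc abs_mult)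
    then have "real (Suc n) * b (Suc n) = (real n - q) * b n"
      unfolding b_def abs_divide fact_Suc by simp
    then show ?thesis by (simp add: algebra_simps)
  qed
  have bound: "(\<Sum>n<m. b (n + N)) \<le> real N * b N / q" for m
  proof -
    have "q * (\<Sum>n<m. b (n + N)) = (\<Sum>n<m. real (n + N) * b (n + N) - real (Suc n + N) * b (Suc n + N))"
      by (simp only: sum_distrib_left) (intro sum.cong refl, simp add: step [simplified])
    also have "\<dots> = real N * b N - real (m + N) * b (m + N)"
      by (subst sum_lessThan_telescope') simp
    also have "\<dots> \<le> real N * b N" by (simp add: b_def)
    finally show ?thesis using q by (simp add: field_simps)
  qed
  have "summable (\<lambda>n. b (n + N))"
  proof (rule bounded_imp_summable)
    show "b (n + N) \<ge> 0" for n by (simp add: b_def)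
    show "(\<Sum>k\<le>n. b (k + N)) \<le> real N * b N / q" for n
      using bound[of "Suc n"] unfolding lessThan_Suc_atMost .
  qed
  then have "summable (\<lambda>n. b n)" by (subst (asm) summable_iff_shift)
  then show ?thesis by (simp add: b_def)
qed

text \<open>The binomial series at \<open>- w\<close>: the sign \<open>(- 1) ^ n\<close> between the
  binomial coefficient and the Pochhammer symbol cancels that of \<open>(- w) ^ n\<close>.\<close>

lemma gen_binomial_pochhammer:
  fixes q w :: real
  assumes "\<bar>w\<bar> < 1"
  shows "(\<lambda>n. pochhammer (- q) n / fact n * w ^ n) sums (1 - w) powr q"
proof -
  have "(q gchoose n) * (- w) ^ n = pochhammer (- q) n / fact n * w ^ n" for n
  proof -
    have "(- 1) ^ n * (- w) ^ n = w ^ n" by (simp flip: power_mult_distrib)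
    then show ?thesis by (simp add: gbinomial_pochhammer mult_ac)
  qed
  then show ?thesis using gen_binomial_real[of "- w" q] assms by simp
qed

text \<open>A power series that converges at some \<open>t\<close> with
  \<open>\<bar>z\<bar> < t < 1\<close> converges absolutely at \<open>z\<close>.\<close>

lemma summable_abs_gen_binomial:
  fixes q z :: real
  assumes "\<bar>z\<bar> < 1"
  shows "summable (\<lambda>n. \<bar>pochhammer (- q) n / fact n * z ^ n\<bar>)"
proof -
  obtain t where t: "\<bar>z\<bar> < t" "t < 1" using dense[OF assms] by blast
  have "summable (\<lambda>n. pochhammer (- q) n / fact n * t ^ n)"
    using t by (intro sums_summable[OF gen_binomial_pochhammer]) auto
  from powser_insidea[OF this, of z] t show ?thesis by simp
qed

text \<open>A factor \<open>(u / (1 + u)) ^ n\<close> raises the first parameter of the kernel by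
  \<open>n\<close>. The normalising constants leave a quotient of Beta values, which is the
  Pochhammer quotient.\<close>

lemma integral_beta_prime_power_mult:
  fixes x y :: real
  assumes xy: "x > 0" "y > 0" and [measurable]: "g \<in> borel_measurable borel" and g: "\<And>u. g u \<ge> 0"
  shows "(\<integral>u. (u / (1 + u)) ^ n * g u \<partial>beta_prime x y) =
    pochhammer x n / pochhammer (x + y) n * (\<integral>u. g u \<partial>beta_prime (x + n) y)"
proof -
  have xn: "x + n > 0" using xy by simp
  note B = Beta_real_pos[OF xy] Beta_real_pos[OF xn xy(2)]
  have "ennreal (Beta x y) * (\<integral>\<^sup>+u. ennreal ((u / (1 + u)) ^ n * g u) \<partial>beta_prime x y) =
     (\<integral>\<^sup>+u. ennreal (beta_prime_kernel x y u) * ennreal ((u / (1 + u)) ^ n * g u) \<partial>lborel)"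
    using xy by (subst nn_integral_beta_prime) auto
  also have "\<dots> = (\<integral>\<^sup>+u. ennreal (beta_prime_kernel (x + n) y u) * ennreal (g u) \<partial>lborel)"
  proof (rule nn_integral_cong)
    fix u
    show "ennreal (beta_prime_kernel x y u) * ennreal ((u / (1 + u)) ^ n * g u) =
       ennreal (beta_prime_kernel (x + n) y u) * ennreal (g u)"
    proof (cases "u > 0")
      case True
      have "beta_prime_kernel x y u * (u / (1 + u)) ^ n = beta_prime_kernel (x + n) y u"
      proof -
        have A: "u powr (x - 1) * u ^ n = u powr (x + n - 1)"
          using True by (simp add: powr_realpow [symmetric] powr_add [symmetric] algebra_simps)
        have B: "(1 + u) powr - (x + y) / (1 + u) ^ n = (1 + u) powr - (x + n + y)"
        proof -
          have "(1 + u) ^ n = (1 + u) powr n" using True by (simp add: powr_realpow)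
          then show ?thesis by (simp flip: powr_diff add: algebra_simps)
        qed
        have "beta_prime_kernel x y u * (u / (1 + u)) ^ n =
            (u powr (x - 1) * u ^ n) * ((1 + u) powr - (x + y) / (1 + u) ^ n)"
          unfolding beta_prime_kernel_def power_divide using True by simp
        also have "\<dots> = beta_prime_kernel (x + n) y u"
          unfolding A B beta_prime_kernel_def using True by simp
        finally show ?thesis .
      qed
      then show ?thesis
        using g beta_prime_kernel_nonneg by (simp add: ennreal_mult' [symmetric] mult.assoc [symmetric])
    qed (simp add: beta_prime_kernel_def)
  qed
  also have "\<dots> = ennreal (Beta (x + n) y) * (\<integral>\<^sup>+u. ennreal (g u) \<partial>beta_prime (x + n) y)"
    using xn xy by (subst nn_integral_beta_prime) auto
  \<comment> \<open>\<open>enn2real\<close> is multiplicative and sends infinity to 0, in agreement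
    with the value 0 of a Bochner integral of a non-integrable function. Thus \<open>g\<close> may
    be non-integrable.\<close>
  finally have "enn2real (ennreal (Beta x y) * (\<integral>\<^sup>+u. ennreal ((u / (1 + u)) ^ n * g u) \<partial>beta_prime x y)) =
      enn2real (ennreal (Beta (x + n) y) * (\<integral>\<^sup>+u. ennreal (g u) \<partial>beta_prime (x + n) y))"
    by (rule arg_cong)
  then have "Beta x y * enn2real (\<integral>\<^sup>+u. ennreal ((u / (1 + u)) ^ n * g u) \<partial>beta_prime x y) =
      Beta (x + n) y * enn2real (\<integral>\<^sup>+u. ennreal (g u) \<partial>beta_prime (x + n) y)"
    using B by (simp only: enn2real_mult enn2real_ennreal less_imp_le)
  moreover have "i = b / a * j" if "a * i = b * j" "a > 0" for a b i j :: real
    using that by (simp add: field_simps)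
  ultimately have "enn2real (\<integral>\<^sup>+u. ennreal ((u / (1 + u)) ^ n * g u) \<partial>beta_prime x y) =
      Beta (x + n) y / Beta x y * enn2real (\<integral>\<^sup>+u. ennreal (g u) \<partial>beta_prime (x + n) y)"
    using B(1) by blast
  moreover have "(\<integral>u. (u / (1 + u)) ^ n * g u \<partial>beta_prime x y) = enn2real (\<integral>\<^sup>+u. ennreal ((u / (1 + u)) ^ n * g u) \<partial>beta_prime x y)"
    by (intro integral_eq_nn_integral) (auto intro!: eventually_mono[OF AE_beta_prime_pos] simp: g)
  moreover have "(\<integral>u. g u \<partial>beta_prime (x + n) y) = enn2real (\<integral>\<^sup>+u. ennreal (g u) \<partial>beta_prime (x + n) y)"
    by (intro integral_eq_nn_integral) (auto simp: g)
  moreover have "Beta (x + n) y / Beta x y = pochhammer x n / pochhammer (x + y) n"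
  proof -
    have "x \<notin> \<int>\<^sub>\<le>\<^sub>0" "x + y \<notin> \<int>\<^sub>\<le>\<^sub>0" using xy by (auto elim!: nonpos_Ints_cases)
    moreover have "Gamma (x + y) > 0" "Gamma x > 0" "Gamma y > 0" "Gamma (x + n) > 0" "Gamma (x + y + n) > 0"
      using xy by (auto intro!: Gamma_real_pos)
    ultimately show ?thesis
      by (simp add: pochhammer_Gamma Beta_def field_simps)
  qed
  ultimately show ?thesis by (simp only:)
qed

lemma integrable_beta_prime_bounded:
  fixes f :: "real \<Rightarrow> real"
  assumes xy: "x > 0" "y > 0" and [measurable]: "f \<in> borel_measurable borel"
    and "\<And>u. u > 0 \<Longrightarrow> \<bar>f u\<bar> \<le> C"
  shows "integrable (beta_prime x y) f"
proof -
  interpret prob_space "beta_prime x y" by (rule prob_space_beta_prime) fact+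
  show ?thesis
    by (rule integrable_const_bound[where B = C]) (auto intro!: eventually_mono[OF AE_beta_prime_pos] simp: assms)
qed

text \<open>Euler's integral for the hypergeometric function, in the variable \<open>t = u / (1 + u)\<close>.\<close>

lemma hypergeometric_sums_integral:
  fixes x y q z :: real
  assumes xy: "x > 0" "y > 0" and z: "0 \<le> z" "z \<le> 1"
    and sum: "summable (\<lambda>n. \<bar>pochhammer (- q) n / fact n * z ^ n\<bar>)"
  shows "(\<lambda>n. pochhammer x n * pochhammer (- q) n / pochhammer (x + y) n * (z ^ n / fact n)) sums
    (\<integral>u. (1 - z * (u / (1 + u))) powr q \<partial>beta_prime x y)"
proof -
  define T where "T u = u / (1 + u)" for u :: real
  have T: "0 < T u" "T u < 1" if "u > 0" for u using that by (auto simp: T_def)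
  have [measurable]: "T \<in> borel_measurable borel" unfolding T_def by measurable
  define c where "c n = pochhammer (- q) n / fact n * z ^ n" for n
  interpret prob_space "beta_prime x y" by (rule prob_space_beta_prime) fact+
  have T1: "\<bar>T u ^ n\<bar> \<le> 1" if "u > 0" for u n
    using T[OF that] by (simp add: power_abs power_le_one)
  have int: "integrable (beta_prime x y) (\<lambda>u. c n * T u ^ n)" for n
    using T1 by (intro integrable_beta_prime_bounded[where C = "\<bar>c n\<bar>"] xy)
      (auto simp: abs_mult intro!: mult_left_le)
  \<comment> \<open>A bound uniform in \<open>u\<close>: absolute summability of \<open>c\<close>
    then justifies exchanging sum and integral, also at \<open>z = 1\<close>.\<close>
  have le: "norm (c n * T u ^ n) \<le> \<bar>c n\<bar>" if "u > 0" for u n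
    using T1[OF that] by (auto simp: abs_mult intro!: mult_left_le)
  have sc: "summable (\<lambda>n. \<bar>c n\<bar>)" using sum by (simp add: c_def)
  have "(\<lambda>n. \<integral>u. c n * T u ^ n \<partial>beta_prime x y) sums (\<integral>u. (\<Sum>n. c n * T u ^ n) \<partial>beta_prime x y)"
  proof (rule sums_integral[OF int])
    show "AE u in beta_prime x y. summable (\<lambda>n. norm (c n * T u ^ n))"
      by (rule eventually_mono[OF AE_beta_prime_pos])
        (auto intro!: summable_comparison_test'[OF sc] simp: le[simplified])
    show "summable (\<lambda>n. \<integral>u. norm (c n * T u ^ n) \<partial>beta_prime x y)"
    proof (rule summable_comparison_test'[OF sc])
      fix n :: nat
      have "(\<integral>u. norm (c n * T u ^ n) \<partial>beta_prime x y) \<le> (\<integral>u. \<bar>c n\<bar> \<partial>beta_prime x y)"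
        using le by (intro integral_mono_AE integrable_norm int) (auto intro!: eventually_mono[OF AE_beta_prime_pos])
      then show "norm (\<integral>u. norm (c n * T u ^ n) \<partial>beta_prime x y) \<le> \<bar>c n\<bar>"
        using prob_space by (simp add: integral_nonneg_AE)
    qed
  qed
  moreover have "(\<integral>u. (\<Sum>n. c n * T u ^ n) \<partial>beta_prime x y) = (\<integral>u. (1 - z * T u) powr q \<partial>beta_prime x y)"
  proof (rule integral_cong_AE)
    show "AE u in beta_prime x y. (\<Sum>n. c n * T u ^ n) = (1 - z * T u) powr q"
    proof (rule eventually_mono[OF AE_beta_prime_pos])
      fix u :: real assume "u > 0"
      then have "0 < T u" "T u < 1" by (rule T)+
      \<comment> \<open>The strict bound \<open>T u < 1\<close> keeps \<open>z * T u\<close> inside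
        the disc of convergence even when \<open>z = 1\<close>.\<close>
      moreover from this have "z * T u \<le> 1 * T u" using z by (intro mult_right_mono) auto
      moreover from calculation have "0 \<le> z * T u" using z by simp
      ultimately have "\<bar>z * T u\<bar> < 1" by linarith
      from gen_binomial_pochhammer[OF this, of q]
      show "(\<Sum>n. c n * T u ^ n) = (1 - z * T u) powr q"
        by (intro sums_unique [symmetric]) (simp add: c_def power_mult_distrib mult_ac)
    qed
  qed measurable
  moreover have "(\<integral>u. c n * T u ^ n \<partial>beta_prime x y) =
      pochhammer x n * pochhammer (- q) n / pochhammer (x + y) n * (z ^ n / fact n)" for n
  proof -
    interpret b: prob_space "beta_prime (x + n) y" using xy by (intro prob_space_beta_prime) auto
    \<comment> \<open>Taking \<open>g = 1\<close> in the parameter shift gives the moments of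
      \<open>T\<close>.\<close>
    have "(\<integral>u. T u ^ n * 1 \<partial>beta_prime x y) = pochhammer x n / pochhammer (x + y) n * (\<integral>u. 1 \<partial>beta_prime (x + n) y)"
      unfolding T_def by (rule integral_beta_prime_power_mult[OF xy]) simp_all
    also have "(\<integral>u. 1 \<partial>beta_prime (x + n) y) = (1 :: real)"
      using b.prob_space by simp
    finally have "(\<integral>u. T u ^ n \<partial>beta_prime x y) = pochhammer x n / pochhammer (x + y) n"
      by simp
    then show "(\<integral>u. c n * T u ^ n \<partial>beta_prime x y) = pochhammer x n * pochhammer (- q) n / pochhammer (x + y) n * (z ^ n / fact n)"
      by (simp only: integral_mult_right_zero c_def) (simp add: mult_ac)
  qed
  ultimately show ?thesis by (simp only: T_def)
qed

section \<open>Two-sided bounds for the expectation of \<open>(1 - z * T) powr p\<close> under the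
  beta prime law\<close>

lemma integrable_beta_prime_powr:
  fixes x y z p :: real
  assumes xy: "x > 0" "y > 0" and z: "0 \<le> z" "z \<le> 1" and p: "p \<ge> 0"
  shows "integrable (beta_prime x y) (\<lambda>u. (1 - z * (u / (1 + u))) powr p)"
proof (rule integrable_beta_prime_bounded[OF xy])
  fix u :: real assume u: "u > 0"
  have "0 \<le> z * (u / (1 + u))" using z u by simp
  moreover have "z * (u / (1 + u)) \<le> 1 * 1" using z u by (intro mult_mono) auto
  ultimately show "\<bar>(1 - z * (u / (1 + u))) powr p\<bar> \<le> 1"
    unfolding abs_of_nonneg[OF powr_ge_zero] by (intro powr_le1 p) linarith+
qed measurable

text \<open>Each estimate integrates a Bernoulli inequality at \<open>w = z * T\<close>. The direct
  form gives the bound \<open>k\<close> since \<open>T\<close> has mean \<open>s\<close>. The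
  inverse form leaves the weight \<open>T\<close>, which changes the law \<open>N\<close> into
  \<open>N'\<close>, and there Euler's integral produces \<open>F\<close>.\<close>

lemma beta_prime_integral_bounds:
  fixes s p z :: real
  assumes s: "0 < s" "s < 1" and p: "p > 0" and z: "0 \<le> z" "z < 1"
  defines "R \<equiv> (\<integral>u. (1 - z * (u / (1 + u))) powr p \<partial>beta_prime (s / 2) ((1 - s) / 2))"
    and "k \<equiv> - (s * p * z)"
    and "F \<equiv> hypergeo_F (1 + s / 2) (1 - p) (3 / 2) 1"
  shows "p \<le> 1 \<Longrightarrow> ereal k * F \<le> ereal (R - 1) \<and> R - 1 \<le> k"
    and "p > 1 \<Longrightarrow> k \<le> R - 1 \<and> ereal (R - 1) \<le> ereal k * F \<and> R - 1 \<le> 0"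
proof -
  define T where "T u = u / (1 + u)" for u :: real
  have T: "0 < T u" "T u < 1" if "u > 0" for u using that by (auto simp: T_def)
  have [measurable]: "T \<in> borel_measurable borel" unfolding T_def by measurable
  have xy: "s / 2 > 0" "(1 - s) / 2 > 0" and xy': "1 + s / 2 > 0" using s by auto
  define N where "N = beta_prime (s / 2) ((1 - s) / 2)"
  define N' where "N' = beta_prime (1 + s / 2) ((1 - s) / 2)"
  have [measurable_cong]: "sets N = sets borel" "sets N' = sets borel" by (simp_all add: N_def N'_def)
  interpret N: prob_space N unfolding N_def by (rule prob_space_beta_prime) fact+
  interpret N': prob_space N' unfolding N'_def by (rule prob_space_beta_prime) fact+
  note int = integrable_beta_prime_bounded[OF xy, folded N_def]
  note int' = integrable_beta_prime_bounded[OF xy' xy(2), folded N'_def]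
  have AE: "AE u in N. u > 0" "AE u in N'. u > 0" unfolding N_def N'_def by (rule AE_beta_prime_pos)+
  have w: "0 \<le> v * T u" "v * T u < 1" "1 - v \<le> 1 - v * T u" "v * T u \<le> T u" if "u > 0" "0 \<le> v" "v \<le> 1" for u v
  proof -
    have "v * T u \<le> 1 * T u" "v * T u \<le> v * 1"
      using T[OF that(1)] that by (intro mult_right_mono mult_left_mono; simp)+
    then show "v * T u < 1" "1 - v \<le> 1 - v * T u" "v * T u \<le> T u" using T[OF that(1)] by linarith+
    show "0 \<le> v * T u" using T[OF that(1)] that by simp
  qed
  have intR: "integrable N (\<lambda>u. (1 - z * T u) powr p)"
    unfolding N_def T_def using z p by (intro integrable_beta_prime_powr xy) auto
  have R: "R = (\<integral>u. (1 - z * T u) powr p \<partial>N)" by (simp add: R_def N_def T_def)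
  \<comment> \<open>The parameter shift for \<open>n = 1\<close>; the factor \<open>s\<close> is the
    quotient of \<open>s / 2\<close> and \<open>1 / 2\<close>.\<close>
  have shift: "(\<integral>u. T u * g u \<partial>N) = s * (\<integral>u. g u \<partial>N')"
    if [measurable]: "g \<in> borel_measurable borel" and "\<And>u. g u \<ge> 0" for g
  proof -
    have e: "s / 2 + (1 - s) / 2 = 1 / 2" by (simp add: field_simps)
    show ?thesis
      using integral_beta_prime_power_mult[OF xy that, of 1]
      unfolding e by (simp add: T_def N_def N'_def add.commute)
  qed
  have ET: "(\<integral>u. T u \<partial>N) = s"
    using shift[of "\<lambda>_. 1"] N'.prob_space by simp
  have intT: "integrable N T"
  proof (rule int)
    show "\<bar>T u\<bar> \<le> 1" if "u > 0" for u using T[OF that] by simp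
  qed measurable
  \<comment> \<open>Euler's integral for the series with parameters \<open>1 + s / 2\<close>,
    \<open>1 - p\<close>, \<open>3 / 2\<close> at the point \<open>v\<close>.\<close>
  define J where "J v = (\<integral>u. (1 - v * T u) powr (p - 1) \<partial>N')" for v
  have J0: "J v \<ge> 0" for v unfolding J_def by (intro integral_nonneg_AE) auto
  have sJ: "(\<integral>u. T u * (1 - v * T u) powr (p - 1) \<partial>N) = s * J v" for v
    unfolding J_def by (rule shift) auto
  \<comment> \<open>For \<open>p < 1\<close> the exponent is negative and the bound
    \<open>(1 - v) powr (p - 1)\<close> calls for \<open>v < 1\<close>.\<close>
  have bq: "\<exists>C. \<forall>u>0. \<bar>(1 - v * T u) powr (p - 1)\<bar> \<le> C" if v: "0 \<le> v" "v \<le> 1" "v < 1 \<or> p \<ge> 1" for v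
  proof (cases "p \<ge> 1")
    case True
    have "\<bar>(1 - v * T u) powr (p - 1)\<bar> \<le> 1" if "u > 0" for u
      using powr_le1[of "p - 1" "1 - v * T u"] w[OF that v(1,2)] True by simp
    then show ?thesis by blast
  next
    case False
    have "\<bar>(1 - v * T u) powr (p - 1)\<bar> \<le> (1 - v) powr (p - 1)" if "u > 0" for u
      using powr_mono2'[of "p - 1" "1 - v" "1 - v * T u"] w[OF that v(1,2)] False v(3) by simp
    then show ?thesis by blast
  qed
  have intJ: "integrable N (\<lambda>u. T u * (1 - v * T u) powr (p - 1))" if v: "0 \<le> v" "v \<le> 1" "v < 1 \<or> p \<ge> 1" for v
  proof -
    obtain C where C: "\<And>u. u > 0 \<Longrightarrow> \<bar>(1 - v * T u) powr (p - 1)\<bar> \<le> C" using bq[OF v] by blast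
    show ?thesis
    proof (rule int[where C = C])
      fix u :: real assume u: "u > 0"
      have "\<bar>T u\<bar> * \<bar>(1 - v * T u) powr (p - 1)\<bar> \<le> 1 * C"
        using T[OF u] C[OF u] by (intro mult_mono) auto
      then show "\<bar>T u * (1 - v * T u) powr (p - 1)\<bar> \<le> C" by (simp add: abs_mult)
    qed measurable
  qed
  \<comment> \<open>At \<open>v = 1\<close> absolute summability comes from the telescoping
    estimate, which asks for \<open>p - 1 > 0\<close>.\<close>
  have sums: "(\<lambda>n. pochhammer (1 + s / 2) n * pochhammer (1 - p) n / pochhammer (3 / 2) n * (v ^ n / fact n)) sums J v"
    if v: "0 \<le> v" "v \<le> 1" "v < 1 \<or> p > 1" for v
  proof -
    have "summable (\<lambda>n. \<bar>pochhammer (- (p - 1)) n / fact n * v ^ n\<bar>)"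
    proof (cases "v < 1")
      case True
      then show ?thesis using v by (intro summable_abs_gen_binomial) auto
    next
      case False
      then have "v = 1" "p - 1 > 0" using v by auto
      then show ?thesis using summable_abs_pochhammer_neg[of "p - 1"] by simp
    qed
    then have "(\<lambda>n. pochhammer (1 + s / 2) n * pochhammer (- (p - 1)) n / pochhammer (1 + s / 2 + (1 - s) / 2) n * (v ^ n / fact n)) sums J v"
      unfolding J_def N'_def T_def by (rule hypergeometric_sums_integral[OF xy' xy(2) v(1,2)])
    moreover have "1 + s / 2 + (1 - s) / 2 = 3 / 2" by (simp add: field_simps)
    ultimately show ?thesis by (simp only: minus_diff_eq)
  qed
  have k0: "k \<le> 0" using s p z by (simp add: k_def)
  {
    \<comment> \<open>\<open>F\<close> may be infinite here, so the integral estimate is made at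
      \<open>z < 1\<close>. Afterwards \<open>J z\<close> is compared with \<open>F\<close> term by
      term, the coefficients being nonnegative because \<open>1 - p \<ge> 0\<close>.\<close>
    assume p1: "p \<le> 1"
    have "R \<le> (\<integral>u. 1 + - (p * z) * T u \<partial>N)"
      unfolding R
    proof (intro integral_mono_AE intR eventually_mono[OF AE(1)])
      show "integrable N (\<lambda>u. 1 + - (p * z) * T u)" using intT by simp
      show "(1 - z * T u) powr p \<le> 1 + - (p * z) * T u" if "u > 0" for u
        using powr_le_Bernoulli[of "1 - z * T u" p] w[OF that, of z] z p p1 by (simp add: mult.assoc)
    qed
    also have "\<dots> = 1 + k" using intT ET N.prob_space by (simp add: k_def)
    finally have "R - 1 \<le> k" by simp
    moreover have "1 - R \<le> p * z * (s * J z)"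
    proof -
      have "1 - R = (\<integral>u. 1 - (1 - z * T u) powr p \<partial>N)"
        using intR N.prob_space by (simp add: R)
      also have "\<dots> \<le> (\<integral>u. p * z * (T u * (1 - z * T u) powr (p - 1)) \<partial>N)"
      proof (intro integral_mono_AE eventually_mono[OF AE(1)])
        show "integrable N (\<lambda>u. p * z * (T u * (1 - z * T u) powr (p - 1)))"
          using intJ[of z] z by simp
        show "1 - (1 - z * T u) powr p \<le> p * z * (T u * (1 - z * T u) powr (p - 1))" if "u > 0" for u
          using powr_Bernoulli_inverse(1)[of "z * T u" p] w[OF that, of z] z p p1 by (simp add: mult.assoc)
      qed (use intR in simp)
      also have "\<dots> = p * z * (s * J z)" by (simp add: sJ)
      finally show ?thesis .
    qed
    then have "k * J z \<le> R - 1" by (simp add: k_def algebra_simps)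
    moreover have "ereal (J z) \<le> F"
    proof -
      let ?a = "\<lambda>n. pochhammer (1 + s / 2) n * pochhammer (1 - p) n / pochhammer (3 / 2 :: real) n"
      have poch: "pochhammer a n \<ge> 0" if "a \<ge> 0" for a :: real and n
        using that by (cases "a = 0") (auto simp: pochhammer_0_left intro!: less_imp_le pochhammer_pos)
      have a0: "?a n \<ge> 0" for n
        using p1 s by (intro divide_nonneg_nonneg mult_nonneg_nonneg poch) auto
      have "ereal (J z) = (\<Sum>n. ereal (?a n * (z ^ n / fact n)))"
        by (intro sums_unique, unfold sums_ereal, rule sums) (use z in auto)
      also have "\<dots> \<le> F"
        unfolding F_def hypergeo_F_def
      proof (rule suminf_le_pos)
        show "ereal (?a n * (z ^ n / fact n)) \<le> ereal (?a n * (1 ^ n / fact n))" for n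
          unfolding ereal_less_eq power_one
          using z by (intro mult_left_mono divide_right_mono a0 power_le_one) auto
        have "0 \<le> ?a n * (z ^ n / fact n)" for n
          using z by (intro mult_nonneg_nonneg a0 divide_nonneg_nonneg) auto
        then show "0 \<le> ereal (?a n * (z ^ n / fact n))" for n
          by (simp only: zero_ereal_def ereal_less_eq)
      qed
      finally show ?thesis .
    qed
    \<comment> \<open>Multiplication is monotone for the nonnegative factor \<open>- k\<close>; the
      sign is moved back afterwards. For \<open>k = 0\<close> and infinite \<open>F\<close> the
      product is 0 by convention.\<close>
    then have "ereal (- k) * ereal (J z) \<le> ereal (- k) * F"
      using k0 by (intro ereal_mult_left_mono) auto
    then have "ereal k * F \<le> ereal k * ereal (J z)"
      by (simp only: uminus_ereal.simps(1) [symmetric] ereal_mult_minus_left ereal_minus_le_minus)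
    moreover have "ereal k * ereal (J z) \<le> ereal (R - 1)"
      using \<open>k * J z \<le> R - 1\<close> by simp
    ultimately show "ereal k * F \<le> ereal (R - 1) \<and> R - 1 \<le> k"
      by (blast intro: order_trans)
  }
  {
    \<comment> \<open>The coefficients now change sign, so no comparison by terms is possible.
      Instead \<open>F\<close> is the finite integral \<open>J 1\<close>, and integrands are
      compared through
      \<open>(1 - T u) powr (p - 1) \<le> (1 - z * T u) powr (p - 1)\<close>.\<close>
    assume p_gt: "p > 1"
    then have p1: "p \<ge> 1" by simp
    have F: "F = ereal (J 1)"
      unfolding F_def hypergeo_F_def
      by (intro sums_unique [symmetric], unfold sums_ereal, rule sums) (use p_gt in auto)
    have "(\<integral>u. 1 + - (p * z) * T u \<partial>N) \<le> R"
      unfolding R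
    proof (intro integral_mono_AE intR eventually_mono[OF AE(1)])
      show "integrable N (\<lambda>u. 1 + - (p * z) * T u)" using intT by simp
      show "1 + - (p * z) * T u \<le> (1 - z * T u) powr p" if "u > 0" for u
        using powr_ge_Bernoulli[of "1 - z * T u" p] w[OF that, of z] z p1 by (simp add: mult.assoc)
    qed
    moreover have "(\<integral>u. 1 + - (p * z) * T u \<partial>N) = 1 + k" using intT ET N.prob_space by (simp add: k_def)
    ultimately have "k \<le> R - 1" by simp
    moreover have "p * z * (s * J 1) \<le> 1 - R"
    proof -
      have "p * z * (s * J 1) = (\<integral>u. p * z * (T u * (1 - 1 * T u) powr (p - 1)) \<partial>N)"
        by (simp add: sJ [symmetric])
      also have "\<dots> \<le> (\<integral>u. 1 - (1 - z * T u) powr p \<partial>N)"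
      proof (intro integral_mono_AE eventually_mono[OF AE(1)])
        show "integrable N (\<lambda>u. p * z * (T u * (1 - 1 * T u) powr (p - 1)))"
          using intJ[of 1] p1 by simp
        show "p * z * (T u * (1 - 1 * T u) powr (p - 1)) \<le> 1 - (1 - z * T u) powr p" if "u > 0" for u
        proof -
          have "(1 - 1 * T u) powr (p - 1) \<le> (1 - z * T u) powr (p - 1)"
            using w[OF that, of z] z p1 T[OF that] by (intro powr_mono2) auto
          then have "p * z * (T u * (1 - 1 * T u) powr (p - 1)) \<le> p * z * (T u * (1 - z * T u) powr (p - 1))"
            using z p T[OF that] by (intro mult_left_mono) auto
          also have "\<dots> \<le> 1 - (1 - z * T u) powr p"
            using powr_Bernoulli_inverse(2)[of "z * T u" p] w[OF that, of z] z p1 by (simp add: mult.assoc)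
          finally show ?thesis .
        qed
      qed (use intR in simp)
      also have "\<dots> = 1 - R" using intR N.prob_space by (simp add: R)
      finally show ?thesis .
    qed
    then have kJ: "R - 1 \<le> k * J 1" by (simp add: k_def algebra_simps)
    moreover have "k * J 1 \<le> 0" using k0 J0[of 1] by (simp add: mult_nonpos_nonneg)
    moreover have "ereal (R - 1) \<le> ereal k * F" using F kJ by simp
    ultimately show "k \<le> R - 1 \<and> ereal (R - 1) \<le> ereal k * F \<and> R - 1 \<le> 0" by linarith
  }
qed

section \<open>Transfer of the bounds to the moments of the Gaussian pair\<close>

theorem theorem2p2:
  fixes M :: "'a measure" and X1 X2 :: "'a \<Rightarrow> real"
    and \<sigma>1 \<sigma>2 \<rho> \<alpha>1 \<alpha>2 :: real
  assumes "prob_space M"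
    and "bivariate_gaussian M X1 X2"
    and "(\<integral>\<omega>. X1 \<omega> \<partial>M) = 0" and "(\<integral>\<omega>. X2 \<omega> \<partial>M) = 0"
    and "\<sigma>1 > 0" and "\<sigma>2 > 0"
    and "(\<integral>\<omega>. (X1 \<omega>)\<^sup>2 \<partial>M) = \<sigma>1\<^sup>2" and "(\<integral>\<omega>. (X2 \<omega>)\<^sup>2 \<partial>M) = \<sigma>2\<^sup>2"
    and "\<rho> = (\<integral>\<omega>. X1 \<omega> * X2 \<omega> \<partial>M) / (\<sigma>1 * \<sigma>2)"
    and "\<bar>\<rho>\<bar> < 1"
    and "-1 < \<alpha>1" and "\<alpha>1 < 0" and "0 < \<alpha>2"
  shows "let
      K = 2 powr ((\<alpha>1 + \<alpha>2) / 2) * \<alpha>1 * \<alpha>2 * \<sigma>1 powr \<alpha>1 * \<sigma>2 powr \<alpha>2 * \<rho>\<^sup>2 / (2 * pi)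
            * Gamma ((\<alpha>1 + 1) / 2) * Gamma ((\<alpha>2 + 1) / 2);
      F1 = hypergeo_F (1 - \<alpha>1 / 2) (1 - \<alpha>2 / 2) (3 / 2) 1;
      D = (\<integral>\<omega>. \<bar>X1 \<omega>\<bar> powr \<alpha>1 * \<bar>X2 \<omega>\<bar> powr \<alpha>2 \<partial>M)
            - (\<integral>\<omega>. \<bar>X1 \<omega>\<bar> powr \<alpha>1 \<partial>M) * (\<integral>\<omega>. \<bar>X2 \<omega>\<bar> powr \<alpha>2 \<partial>M)
    in (\<alpha>2 \<le> 2 \<longrightarrow> ereal K * F1 \<le> ereal D \<and> D \<le> K \<and> K \<le> 0) \<and>
       (\<alpha>2 > 2 \<longrightarrow> K \<le> D \<and> ereal D \<le> min (ereal K * F1) 0)"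
proof -
  have [measurable]: "X1 \<in> borel_measurable M" "X2 \<in> borel_measurable M"
    using assms(2) by (auto simp: bivariate_gaussian_def)
  note law = bivariate_gaussian_nn_integral[OF assms(2-10)]
  define c where "c = \<sigma>1 powr \<alpha>1 * \<sigma>2 powr \<alpha>2"
  define m1 where "m1 = normal_abs_moment \<alpha>1"
  define m2 where "m2 = normal_abs_moment \<alpha>2"
  have pos: "m1 > 0" "m2 > 0" "c > 0"
    using assms by (auto simp: m1_def m2_def c_def intro!: normal_abs_moment_pos)
  let ?N = "beta_prime (- \<alpha>1 / 2) ((1 + \<alpha>1) / 2)"
  define R where "R = (\<integral>u. (1 - \<rho>\<^sup>2 * (u / (1 + u))) powr (\<alpha>2 / 2) \<partial>?N)"
  have z: "0 \<le> \<rho>\<^sup>2" "\<rho>\<^sup>2 < 1" using assms(10) by (auto simp: abs_square_less_1)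
  have R0: "R \<ge> 0" unfolding R_def by (intro integral_nonneg_AE) auto
  have nnR: "(\<integral>\<^sup>+u. ennreal ((1 - \<rho>\<^sup>2 * (u / (1 + u))) powr (\<alpha>2 / 2)) \<partial>?N) = ennreal R"
    unfolding R_def using assms z by (intro nn_integral_eq_integral integrable_beta_prime_powr) auto
  \<comment> \<open>All three expectations have nonnegative homogeneous integrands: scaling by
    \<open>\<sigma>1\<close> and \<open>\<sigma>2\<close> contributes the factor \<open>a\<close>,
    and the finite value \<open>I\<close> is found under the normalised density.\<close>
  have E: "(\<integral>\<omega>. g (X1 \<omega>, X2 \<omega>) \<partial>M) = a * I"
    if [measurable]: "g \<in> borel_measurable (borel \<Otimes>\<^sub>M borel)" and "\<And>p. g p \<ge> 0"
      and sc: "\<And>x y. g (\<sigma>1 * x, \<sigma>2 * y) = a * g (x, y)" and a: "a \<ge> 0" "I \<ge> 0"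
      and I: "(\<integral>\<^sup>+y. \<integral>\<^sup>+x. ennreal (binormal_density \<rho> x y) * ennreal (g (x, y)) \<partial>lborel \<partial>lborel) = ennreal I"
    for g a I
  proof -
    have "(\<integral>\<^sup>+\<omega>. ennreal (g (X1 \<omega>, X2 \<omega>)) \<partial>M) =
        (\<integral>\<^sup>+y. \<integral>\<^sup>+x. ennreal (binormal_density \<rho> x y) * ennreal (g (\<sigma>1 * x, \<sigma>2 * y)) \<partial>lborel \<partial>lborel)"
      by (rule law) measurable
    also have "\<dots> = (\<integral>\<^sup>+y. \<integral>\<^sup>+x. ennreal a * (ennreal (binormal_density \<rho> x y) * ennreal (g (x, y))) \<partial>lborel \<partial>lborel)"
      using a by (simp only: sc ennreal_mult' mult.left_commute)
    also have "\<dots> = ennreal a * ennreal I"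
      by (simp add: nn_integral_cmult I)
    finally show ?thesis
      using that(2) a by (subst integral_eq_nn_integral) (auto simp: ennreal_mult' [symmetric])
  qed
  have E1: "(\<integral>\<omega>. \<bar>X1 \<omega>\<bar> powr \<alpha>1 \<partial>M) = \<sigma>1 powr \<alpha>1 * m1"
    using E[of "\<lambda>p. \<bar>fst p\<bar> powr \<alpha>1" "\<sigma>1 powr \<alpha>1" m1] nn_integral_binormal_fst[OF assms(10,11)] pos assms(5)
    by (simp add: m1_def abs_mult powr_mult)
  have E2: "(\<integral>\<omega>. \<bar>X2 \<omega>\<bar> powr \<alpha>2 \<partial>M) = \<sigma>2 powr \<alpha>2 * m2"
    using E[of "\<lambda>p. \<bar>snd p\<bar> powr \<alpha>2" "\<sigma>2 powr \<alpha>2" m2] nn_integral_binormal_snd[OF assms(10), of \<alpha>2] pos assms(6,13)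
    by (simp add: m2_def abs_mult powr_mult)
  have E12: "(\<integral>\<omega>. \<bar>X1 \<omega>\<bar> powr \<alpha>1 * \<bar>X2 \<omega>\<bar> powr \<alpha>2 \<partial>M) = c * (m1 * m2 * R)"
  proof -
    have "(\<integral>\<^sup>+y. \<integral>\<^sup>+x. ennreal (binormal_density \<rho> x y) * ennreal (\<bar>x\<bar> powr \<alpha>1 * \<bar>y\<bar> powr \<alpha>2) \<partial>lborel \<partial>lborel) = ennreal (m1 * m2 * R)"
      using nn_integral_binormal_powr_powr[of "- \<alpha>1" \<alpha>2 \<rho>] assms(10-13) pos R0
      by (simp add: nnR [simplified] m1_def m2_def ennreal_mult')
    then show ?thesis
      using E[of "\<lambda>p. \<bar>fst p\<bar> powr \<alpha>1 * \<bar>snd p\<bar> powr \<alpha>2" c "m1 * m2 * R"] pos R0 assms(5,6)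
      by (simp add: c_def abs_mult powr_mult mult_ac)
  qed
  \<comment> \<open>\<open>C\<close> is the product of the two marginal moments.\<close>
  define C where "C = c * m1 * m2"
  \<comment> \<open>Kept in the shape \<open>- (s * p * z)\<close> with
    \<open>s = - \<alpha>1\<close>, \<open>p = \<alpha>2 / 2\<close> and
    \<open>z = \<rho>^2\<close>, so that the bounds can be folded to it.\<close>
  define k where "k = - (- \<alpha>1 * (\<alpha>2 / 2) * \<rho>\<^sup>2)"
  define K where "K = 2 powr ((\<alpha>1 + \<alpha>2) / 2) * \<alpha>1 * \<alpha>2 * \<sigma>1 powr \<alpha>1 * \<sigma>2 powr \<alpha>2 * \<rho>\<^sup>2 / (2 * pi)
            * Gamma ((\<alpha>1 + 1) / 2) * Gamma ((\<alpha>2 + 1) / 2)"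
  define F1 where "F1 = hypergeo_F (1 - \<alpha>1 / 2) (1 - \<alpha>2 / 2) (3 / 2) 1"
  define D where "D = (\<integral>\<omega>. \<bar>X1 \<omega>\<bar> powr \<alpha>1 * \<bar>X2 \<omega>\<bar> powr \<alpha>2 \<partial>M)
            - (\<integral>\<omega>. \<bar>X1 \<omega>\<bar> powr \<alpha>1 \<partial>M) * (\<integral>\<omega>. \<bar>X2 \<omega>\<bar> powr \<alpha>2 \<partial>M)"
  have C: "C > 0" using pos by (simp add: C_def)
  have D: "D = C * (R - 1)"
    unfolding D_def E1 E2 E12 C_def c_def by (simp add: algebra_simps)
  \<comment> \<open>The factors \<open>1 / sqrt pi\<close> of the two moments give
    \<open>1 / pi\<close>, and the 2 in \<open>\<alpha>2 / 2\<close> completes the denominator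
    \<open>2 * pi\<close>.\<close>
  have K: "K = C * k"
  proof -
    have "2 powr ((\<alpha>1 + \<alpha>2) / 2) = 2 powr (\<alpha>1 / 2) * 2 powr (\<alpha>2 / 2)"
      by (simp add: powr_add add_divide_distrib)
    then have "m1 * m2 = 2 powr ((\<alpha>1 + \<alpha>2) / 2) * Gamma ((\<alpha>1 + 1) / 2) * Gamma ((\<alpha>2 + 1) / 2) / pi"
      by (simp add: m1_def m2_def normal_abs_moment_def)
    then show ?thesis unfolding C_def mult.assoc[of c] by (simp add: K_def k_def c_def mult_ac)
  qed
  have k0: "k \<le> 0" using assms by (simp add: k_def mult_nonpos_nonneg)
  have F1: "hypergeo_F (1 + - \<alpha>1 / 2) (1 - \<alpha>2 / 2) (3 / 2) 1 = F1"
    by (simp add: F1_def)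
  have scale: "ereal K * F1 = ereal C * (ereal k * F1)"
    unfolding K by (simp only: times_ereal.simps(1) [symmetric] mult.assoc)
  note bounds = beta_prime_integral_bounds[of "- \<alpha>1" "\<alpha>2 / 2" "\<rho>\<^sup>2", simplified diff_minus_eq_add, folded R_def k_def, unfolded F1]
  have "(\<alpha>2 \<le> 2 \<longrightarrow> ereal K * F1 \<le> ereal D \<and> D \<le> K \<and> K \<le> 0) \<and>
       (\<alpha>2 > 2 \<longrightarrow> K \<le> D \<and> ereal D \<le> min (ereal K * F1) 0)"
  proof (intro conjI impI)
    assume "\<alpha>2 \<le> 2"
    then have b: "ereal k * F1 \<le> ereal (R - 1)" "R - 1 \<le> k"
      using bounds(1) assms z by auto
    have "ereal C * (ereal k * F1) \<le> ereal C * ereal (R - 1)"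
      using b(1) C by (intro ereal_mult_left_mono) auto
    then show "ereal K * F1 \<le> ereal D" unfolding scale D by simp
    show "D \<le> K" "K \<le> 0" using b(2) k0 C by (auto simp: D K mult_nonneg_nonpos)
  next
    assume "\<alpha>2 > 2"
    then have b: "k \<le> R - 1" "ereal (R - 1) \<le> ereal k * F1" "R - 1 \<le> 0"
      using bounds(2) assms z by auto
    show "K \<le> D" using b(1) C by (auto simp: D K)
    have "ereal C * ereal (R - 1) \<le> ereal C * (ereal k * F1)"
      using b(2) C by (intro ereal_mult_left_mono) auto
    then have "ereal D \<le> ereal K * F1" unfolding scale D by simp
    moreover have "D \<le> 0" using b(3) C by (auto simp: D mult_nonneg_nonpos)
    ultimately show "ereal D \<le> min (ereal K * F1) 0" by (simp add: zero_ereal_def)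
  qed
  then show ?thesis unfolding Let_def K_def F1_def D_def .
qed

end
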